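(* Let $k,r$ be integers with $k>2r+1$ and $r\ge 1$, and let $\zeta=\zeta_{k,r}$ be the substitution on $\{1,\dots,k\}$ defined in the context. (a) The substitution $\zeta$, acting on $\{1,\dots,k\}^{\mathbb N}$, has no fixed points, and it has exactly $r+1$ periodic points $\mathbf u_1,\dots,\mathbf u_{r+1}$, given by $\mathbf u_j=\lim_{m\to\infty}\zeta^{m(r+1)}(2j-1)$ for $1\le j\le r+1$; moreover $\zeta(\mathbf u_i)=\mathbf u_{i+1}$ for $1\le i\le r$ and $\zeta(\mathbf u_{r+1})=\mathbf u_1$. (b) For all $n\ge k$, $$\zeta^n(1)=\underbrace{\zeta^{n-r-1}(1)\zeta^{n-r-2}(1)\cdots\zeta^{n+r-k}(1)}_{k-2r\text{ factors}}\ \underbrace{\zeta^{n-r}(2)\zeta^{n-r+1}(2)\cdots\zeta^{n-1}(2)}_{r\text{ factors}},$$ $$\zeta^n(2)=\underbrace{\zeta^{n-r-1}(1)\zeta^{n-r-2}(1)\cdots\zeta^{n+r-k+1}(1)}_{k-2r-1\text{ factors}}\ \underbrace{\zeta^{n-r}(2)\zeta^{n-r+1}(2)\cdots\zeta^{n-1}(2)}_{r\text{ factors}}.$$ Moreover, for $n\ge k$ it is not possible to express $\zeta^n(1)$ as a juxtaposition (concatenation) of words all of the form $\zeta^j(1)$ with $0\le j\le n-1$. (c) The minimal return time of the symbol $1$ under the substitution $\zeta$ is $r+1$, which is equal to the minimal return time of the vertex $1$ in the graph $\mathcal G_{\zeta_{k,r}}$. Moreover, for any other substitution sharing the graph $\mathcal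 G_{\zeta_{k,r}}$, the minimal return time of the symbol $1$ is larger than $r+1$. (d) The characteristic polynomial of the substitution matrix $M_{\zeta_{k,r}}$ is $p_{k,r}(x)$. (e) $L_{k,r}(n+k)=|\zeta_{k,r}^n(1)|$ for all $n\ge 0$.
   Context: Words and substitutions. Let $\mathcal A=\{1,\dots,k\}$, let $\mathcal A^*$ be the set of finite words over $\mathcal A$, and let $|U|$ denote the length of a word $U$. A substitution is a map $\zeta:\mathcal A\to\mathcal A^*$, extended to $\mathcal A^*$ by concatenation, $\zeta(UV)=\zeta(U)\zeta(V)$, and to one-sided infinite sequences by $\zeta(v_1v_2\cdots)=\zeta(v_1)\zeta(v_2)\cdots$; $\zeta^n$ is the $n$-th iterate and $\zeta^0$ is the identity. A fixed point is $\mathbf v\in\mathcal A^{\mathbb N}$ with $\zeta(\mathbf v)=\mathbf v$; a periodic point is $\mathbf v\in\mathcal A^{\mathbb N}$ with $\zeta^m(\mathbf v)=\mathbf v$ for some $m\ge1$. If $\zeta^m(\mathbf v)=\mathbf v$ with $\mathbf v=v_1v_2\cdots$, then $\zeta^{nm}(v_1)$ is a prefix of $\mathbf v$ for all $n\ge1$ and one writes $\mathbf v=\lim_{n\to\infty}\zeta^{mn}(v_1)$ (the infinite sequence having all these words, whose lengths tend to infinity, as prefixes). The substitution $\zeta_{k,r}$ (for $k\ge 2r+2$, $r\ge1$) is defined on $\{1,\dots,k\}$ as follows, where juxtaposition of symbols denotes a word: $1\mapsto 3\,2$; $j\mapsto (j+2)\,2$ for $2\le j\le 2r$; $j\mapsto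 1\,(j+1)$ for $2r+1\le j\le k-1$; $k\mapsto 1$. The matrix $M_\zeta$ is the $k\times k$ matrix whose $(i,j)$ entry is the number of occurrences of the symbol $i$ in the word $\zeta(j)$. The graph $\mathcal G_\zeta$ is the directed graph with vertex set $\mathcal A$ and an edge from $a$ to $b$ whenever $b$ occurs in $\zeta(a)$ (its adjacency matrix is taken to correspond to $M_\zeta$). The minimal return time of a vertex $v$ in a directed graph is the minimal length of a (nonempty) path starting and ending at $v$. The minimal return time of a symbol $a$ under a substitution $\zeta$ is the smallest $j\ge1$ such that $\zeta^j(a)$ starts with the symbol $a$ (infinite if there is no such $j$). The polynomial is $p_{k,r}(x)=x^k-x^{k-1}-\cdots-x^r+x^{r-1}+\cdots+x+1$, i.e. $p_{k,r}(x)=x^k-\sum_{i=r}^{k-1}x^i+\sum_{i=0}^{r-1}x^i$. The sequence $\{L_{k,r}(n)\}_{n\ge0}$ (the $(k,r)$-Lorenz-Fibonacci sequence of the first kind) is defined by $L_{k,r}(0)=\cdots=L_{k,r}(k-2)=0$, $L_{k,r}(k-1)=1$ and, for $n\ge0$, $L_{k,r}(n+k)=\sum_{j=r}^{k-1}L_{k,r}(n+j)-\sum_{j=0}^{r-1}L_{k,r}(n+j)$.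
   Formalization: The last claim of (c) is false (2→24 in place of 2→42 keeps the graph and return time r+1); proved instead: for any substitution sharing the graph the return time is ≥ r+1, and > r+1 iff the image of one of 1,3,…,2r+1 has a different first letter than under ζ. *)

theory Defs
  imports
    "HOL-Library.Stream"
    "HOL-Library.Sublist"
    "HOL-Library.Extended_Nat"
    "Jordan_Normal_Form.Char_Poly"
begin

text \<open>The alphabet is \<open>{1..k} :: nat set\<close>. A substitution is a map from letters to words; its
  values outside the alphabet are irrelevant.\<close>

definition subst_word :: "(nat \<Rightarrow> nat list) \<Rightarrow> nat list \<Rightarrow> nat list" where
  "subst_word \<zeta> w = concat (map \<zeta> w)"

text \<open>The library function \<open>flat\<close> is the concatenation of a stream of words only if all of them are
  nonempty, so this definition is meant for non-erasing substitutions.\<close>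

definition subst_stream :: "(nat \<Rightarrow> nat list) \<Rightarrow> nat stream \<Rightarrow> nat stream" where
  "subst_stream \<zeta> v = flat (smap \<zeta> v)"

definition subst_iter :: "(nat \<Rightarrow> nat list) \<Rightarrow> nat \<Rightarrow> nat \<Rightarrow> nat list" where
  "subst_iter \<zeta> n a = (subst_word \<zeta> ^^ n) [a]"

definition fixed_points :: "nat \<Rightarrow> (nat \<Rightarrow> nat list) \<Rightarrow> nat stream set" where
  "fixed_points k \<zeta> = {v \<in> streams {1..k}. subst_stream \<zeta> v = v}"

definition periodic_points :: "nat \<Rightarrow> (nat \<Rightarrow> nat list) \<Rightarrow> nat stream set" where
  "periodic_points k \<zeta> = {v \<in> streams {1..k}. \<exists>m\<ge>1. (subst_stream \<zeta> ^^ m) v = v}"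

definition is_word_limit :: "(nat \<Rightarrow> nat list) \<Rightarrow> nat stream \<Rightarrow> bool" where
  "is_word_limit w v \<longleftrightarrow>
     (\<forall>m. stake (length (w m)) v = w m) \<and> filterlim (\<lambda>m. length (w m)) at_top sequentially"

definition zeta :: "nat \<Rightarrow> nat \<Rightarrow> nat \<Rightarrow> nat list" where
  "zeta k r j =
     (if j = 1 then [3, 2]
      else if 2 \<le> j \<and> j \<le> 2 * r then [j + 2, 2]
      else if 2 * r + 1 \<le> j \<and> j \<le> k - 1 then [1, j + 1]
      else if j = k then [1]
      else [])"

text \<open>The letters \<open>1, \<dots>, k\<close> correspond to the matrix indices \<open>0, \<dots>, k - 1\<close>.\<close>

definition subst_matrix :: "nat \<Rightarrow> (nat \<Rightarrow> nat list) \<Rightarrow> int mat" where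
  "subst_matrix k \<zeta> = mat k k (\<lambda>(i, j). int (count_list (\<zeta> (j + 1)) (i + 1)))"

definition subst_graph :: "nat \<Rightarrow> (nat \<Rightarrow> nat list) \<Rightarrow> (nat \<times> nat) set" where
  "subst_graph k \<zeta> = {(a, b). a \<in> {1..k} \<and> b \<in> set (\<zeta> a)}"

text \<open>Both return times are \<open>\<infinity>\<close>, the infimum of the empty set, if there is no return.\<close>

definition vertex_return_time :: "(nat \<times> nat) set \<Rightarrow> nat \<Rightarrow> enat" where
  "vertex_return_time E v = Inf {enat n |n. 1 \<le> n \<and> (v, v) \<in> E ^^ n}"

definition symbol_return_time :: "(nat \<Rightarrow> nat list) \<Rightarrow> nat \<Rightarrow> enat" where
  "symbol_return_time \<zeta> a = Inf {enat n |n. 1 \<le> n \<and> prefix [a] (subst_iter \<zeta> n a)}"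

definition lorenz_poly :: "nat \<Rightarrow> nat \<Rightarrow> int poly" where
  "lorenz_poly k r = monom 1 k - (\<Sum>i = r..<k. monom 1 i) + (\<Sum>i<r. monom 1 i)"

text \<open>The guard \<open>r \<le> k\<close> only makes the recursion terminate for all arguments.\<close>

fun lorenz_fib :: "nat \<Rightarrow> nat \<Rightarrow> nat \<Rightarrow> int" where
  "lorenz_fib k r n =
     (if n < k then (if n + 1 = k then 1 else 0)
      else if r \<le> k then
        (\<Sum>j = r..<k. lorenz_fib k r (n - k + j)) - (\<Sum>j<r. lorenz_fib k r (n - k + j))
      else 0)"

declare lorenz_fib.simps [simp del]

lemma lorenz_fib_initial:
  assumes "k \<ge> 1"
  shows "\<forall>n < k - 1. lorenz_fib k r n = 0" "lorenz_fib k r (k - 1) = 1"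
  using assms by (auto simp: lorenz_fib.simps)

lemma lorenz_fib_recurrence:
  assumes "r \<le> k"
  shows "lorenz_fib k r (n + k) =
    (\<Sum>j = r..<k. lorenz_fib k r (n + j)) - (\<Sum>j<r. lorenz_fib k r (n + j))"
  using assms by (subst lorenz_fib.simps) simp

end

theory Submission
  imports Defs
begin

text \<open>Taking first letters of images sends every letter eventually into the cycle
  \<open>1, 3, \<dots>, 2 r + 1\<close> and permutes that cycle, so a periodic point is determined by its first
  letter, which lies on the cycle. In the graph a step from a letter at most \<open>2 r\<close> increases the
  letter by at most two and only letters above \<open>2 r\<close> lead back to \<open>1\<close>, so this cycle is also
  the only nonempty path of length at most \<open>r + 1\<close> from \<open>1\<close> to itself. Iterating
  \<open>j \<mapsto> (j + 2) 2\<close> and then \<open>j \<mapsto> 1 (j + 1)\<close> gives the two factorisations in (b).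
  For \<open>0 < n\<close>, the last letter of \<open>\<zeta> ^ n (1)\<close> is \<open>2\<close>, and the images of different letters are
  distinguished from the right, so no \<open>\<zeta> ^ j (1)\<close> with \<open>j < n\<close> is a suffix of \<open>\<zeta> ^ n (1)\<close>.
  The lengths of these words, continued by \<open>1\<close> at \<open>-1\<close> and by \<open>0\<close> at \<open>-2, \<dots>, -k\<close>, satisfy
  the recurrence from \<open>n = 0\<close> on. The characteristic polynomial reduces to a \<open>2 \<times> 2\<close>
  determinant, because the equations of \<open>M w = x w\<close> for the letters \<open>3, \<dots>, k\<close> determine \<open>w\<close>
  from its first two entries.\<close>

section \<open>Substitutions on words and streams\<close>

lemma subst_word_append [simp]: "subst_word s (u @ v) = subst_word s u @ subst_word s v"
  by (simp add: subst_word_def)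

lemma subst_word_Nil [simp]: "subst_word s [] = []"
  by (simp add: subst_word_def)

lemma subst_word_Cons: "subst_word s (a # w) = s a @ subst_word s w"
  by (simp add: subst_word_def)

lemma funpow_subst_word_append:
  "(subst_word s ^^ n) (u @ v) = (subst_word s ^^ n) u @ (subst_word s ^^ n) v"
  by (induction n) auto

lemma funpow_subst_word: "(subst_word s ^^ n) w = concat (map (subst_iter s n) w)"
proof (induction w)
  case Nil
  show ?case by (induction n) auto
next
  case (Cons a w)
  then show ?case
    using funpow_subst_word_append[of n s "[a]" w] by (simp add: subst_iter_def)
qed

lemma subst_iter_0 [simp]: "subst_iter s 0 a = [a]"
  by (simp add: subst_iter_def)

lemma subst_iter_Suc: "subst_iter s (Suc n) a = concat (map (subst_iter s n) (s a))"
  unfolding funpow_subst_word[symmetric]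
  by (simp add: subst_iter_def funpow_swap1 subst_word_Cons)

lemma subst_iter_Suc': "subst_iter s (Suc n) a = subst_word s (subst_iter s n a)"
  by (simp add: subst_iter_def)

lemma subst_iter_add: "subst_iter s (m + n) a = (subst_word s ^^ m) (subst_iter s n a)"
  by (simp add: subst_iter_def funpow_add)

section \<open>Infinite words as limits of finite words\<close>

lemma stake_length_eq_iff: "stake (length w) v = w \<longleftrightarrow> (\<exists>s. v = w @- s)"
proof
  assume "stake (length w) v = w"
  then show "\<exists>s. v = w @- s" by (metis stake_sdrop)
qed (auto simp: stake_shift)

lemma stream_eqI_prefixes:
  assumes "\<And>n. \<exists>w s s'. n \<le> length w \<and> v = w @- s \<and> v' = w @- s'"
  shows "v = v'"
proof -
  have "v !! i = v' !! i" for i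
  proof -
    obtain w s s' where "Suc i \<le> length w" "v = w @- s" "v' = w @- s'"
      using assms[of "Suc i"] by blast
    then show ?thesis by (simp add: shift_snth_less)
  qed
  then show ?thesis using smap_alt[of id v v'] by (simp add: stream.map_id)
qed

lemma ex_word_limit:
  assumes pre: "\<And>m. prefix (w m) (w (Suc m))"
    and lim: "filterlim (\<lambda>m. length (w m)) at_top sequentially"
  shows "\<exists>v. is_word_limit w v"
proof -
  have mono: "prefix (w m) (w n)" if "m \<le> n" for m n
    using that by (induction rule: dec_induct) (use pre prefix_order.trans in blast)+
  have "\<exists>m. i < length (w m)" for i
    using eventually_happens[OF filterlim_at_top[THEN iffD1, OF lim, rule_format, of "Suc i"]]
    by (simp add: Suc_le_eq)
  then obtain N where N: "i < length (w (N i))" for i by metis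
  \<comment> \<open>The words form a chain of prefixes, so every word longer than \<open>i\<close>
    has the same letter at position \<open>i\<close>.\<close>
  define v where "v = smap (\<lambda>i. w (N i) ! i) nats"
  have "stake (length (w m)) v = w m" for m
  proof (rule nth_equalityI)
    fix i assume "i < length (stake (length (w m)) v)"
    then have i: "i < length (w m)" by simp
    have "prefix (w (N i)) (w m) \<or> prefix (w m) (w (N i))"
      by (metis mono nat_le_linear)
    then have "w (N i) ! i = w m ! i"
      using i N[of i] by (auto simp: prefix_def nth_append)
    then show "stake (length (w m)) v ! i = w m ! i" using i by (simp add: v_def)
  qed simp
  then show ?thesis using lim unfolding is_word_limit_def by blast
qed

text \<open>Without erasure \<open>flat\<close> is genuine concatenation, and the first letter of an
  image depends only on the first letter of its argument. The self-map \<open>first\<close> of the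
  alphabet then controls how iterates begin.\<close>

locale nonerasing_subst =
  fixes A :: "nat set" and s :: "nat \<Rightarrow> nat list"
  assumes nonempty: "a \<in> A \<Longrightarrow> s a \<noteq> []"
    and closed: "a \<in> A \<Longrightarrow> set (s a) \<subseteq> A"
begin

abbreviation first :: "nat \<Rightarrow> nat" where "first a \<equiv> hd (s a)"

lemma subst_word_letters: "set w \<subseteq> A \<Longrightarrow> set (subst_word s w) \<subseteq> A"
  using closed by (auto simp: subst_word_def)

lemma subst_word_nonempty: "set w \<subseteq> A \<Longrightarrow> w \<noteq> [] \<Longrightarrow> subst_word s w \<noteq> []"
  using nonempty by (cases w) (auto simp: subst_word_def)

lemma subst_word_hd: "set w \<subseteq> A \<Longrightarrow> w \<noteq> [] \<Longrightarrow> hd (subst_word s w) = first (hd w)"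
  using nonempty by (cases w) (auto simp: subst_word_def)

lemma subst_iter_letters: "a \<in> A \<Longrightarrow> set (subst_iter s n a) \<subseteq> A"
proof (induction n)
  case (Suc n)
  then show ?case using subst_word_letters unfolding subst_iter_Suc' by blast
qed simp

lemma subst_iter_nonempty: "a \<in> A \<Longrightarrow> subst_iter s n a \<noteq> []"
proof (induction n)
  case (Suc n)
  then show ?case using subst_word_nonempty subst_iter_letters unfolding subst_iter_Suc' by blast
qed simp

lemma subst_iter_hd: "a \<in> A \<Longrightarrow> hd (subst_iter s n a) = (first ^^ n) a"
proof (induction n)
  case (Suc n)
  then show ?case
    using subst_word_hd subst_iter_letters subst_iter_nonempty unfolding subst_iter_Suc' by simp
qed simp

lemma first_in: "a \<in> A \<Longrightarrow> first a \<in> A"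
  using nonempty closed hd_in_set by blast

lemma funpow_first_in: "a \<in> A \<Longrightarrow> (first ^^ n) a \<in> A"
  by (induction n) (auto simp: first_in)

lemma length_subst_word_ge: "set w \<subseteq> A \<Longrightarrow> length w \<le> length (subst_word s w)"
proof (induction w)
  case (Cons a w)
  then show ?case
    using nonempty[of a] by (cases "s a") (auto simp: subst_word_Cons)
qed simp

lemma length_subst_iter_mono:
  assumes "a \<in> A" "m \<le> n"
  shows "length (subst_iter s m a) \<le> length (subst_iter s n a)"
  using assms(2)
proof (induction rule: dec_induct)
  case (step n)
  then show ?case
    using length_subst_word_ge[OF subst_iter_letters[OF assms(1)]]
    by (metis order_trans subst_iter_Suc')
qed simp

lemma subst_stream_shift:
  "set w \<subseteq> A \<Longrightarrow> subst_stream s (w @- v) = subst_word s w @- subst_stream s v"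
proof (induction w)
  case (Cons a w)
  then show ?case
    using nonempty[of a] by (auto simp: subst_stream_def subst_word_Cons flat_Stream)
qed (simp add: subst_stream_def)

lemma funpow_subst_stream_shift:
  "a \<in> A \<Longrightarrow> (subst_stream s ^^ n) (a ## v) = subst_iter s n a @- (subst_stream s ^^ n) v"
proof (induction n)
  case (Suc n)
  then show ?case
    by (simp add: subst_iter_Suc' subst_stream_shift subst_iter_letters)
qed simp

lemma shd_funpow_subst_stream:
  assumes "shd v \<in> A"
  shows "shd ((subst_stream s ^^ n) v) = (first ^^ n) (shd v)"
proof -
  obtain a v' where v: "v = a ## v'" by (metis stream.exhaust_sel)
  with assms have "a \<in> A" by simp
  then show ?thesis
    using v by (simp add: funpow_subst_stream_shift subst_iter_nonempty subst_iter_hd shift_simps)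
qed

end

section \<open>Words of the substitution\<close>

text \<open>A nonempty infimum in \<open>enat\<close> is attained: if all \<open>n\<close> with
  \<open>P n\<close> exceeded \<open>N\<close>, then \<open>Suc N\<close> would be a lower
  bound.\<close>

lemma Inf_enat_le_iff: "Inf {enat n |n. P n} \<le> enat N \<longleftrightarrow> (\<exists>n\<le>N. P n)"
proof
  assume le: "Inf {enat n |n. P n} \<le> enat N"
  show "\<exists>n\<le>N. P n"
  proof (rule ccontr)
    assume "\<not> ?thesis"
    then have "enat (Suc N) \<le> Inf {enat n |n. P n}"
      by (intro Inf_greatest) (auto simp: not_le Suc_le_eq)
    with le have "enat (Suc N) \<le> enat N" by (rule order_trans[rotated])
    then show False by simp
  qed
next
  assume "\<exists>n\<le>N. P n"
  then obtain n where "n \<le> N" "P n" by blast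
  then have "Inf {enat n |n. P n} \<le> enat n" by (intro Inf_lower) auto
  with \<open>n \<le> N\<close> show "Inf {enat n |n. P n} \<le> enat N"
    by (meson enat_ord_simps(1) order_trans)
qed

lemma Inf_enat_eqI:
  assumes "P N" "\<And>n. P n \<Longrightarrow> N \<le> n"
  shows "Inf {enat n |n. P n} = enat N"
  using assms by (intro antisym Inf_lower Inf_greatest) auto

lemma map_diff_upt_shift:
  "map (\<lambda>i. f (n - d - i)) [a..<b] = map (\<lambda>i. f (n - i :: nat)) [a + d..<b + d]"
  by (rule nth_equalityI) (auto simp: algebra_simps simp del: upt_Suc)

text \<open>Incomparability in the suffix order, with witnesses: the longest common suffix
  \<open>p\<close> and the distinct letters before it. The effect of a substitution can be computed
  on these witnesses.\<close>

definition suffix_split :: "'a list \<Rightarrow> 'a list \<Rightarrow> bool" where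
  "suffix_split u v \<longleftrightarrow> (\<exists>x y a b p. a \<noteq> b \<and> u = x @ a # p \<and> v = y @ b # p)"

lemma suffix_splitI: "a \<noteq> b \<Longrightarrow> suffix_split (x @ a # p) (y @ b # p)"
  unfolding suffix_split_def by blast

lemma suffix_split_not_suffix: "suffix_split u v \<Longrightarrow> \<not> suffix u v"
proof
  assume "suffix_split u v" "suffix u v"
  then obtain x y z a b p where "a \<noteq> b" "u = x @ a # p" "v = y @ b # p" "v = z @ u"
    unfolding suffix_split_def suffix_def by blast
  then have "(y @ [b]) @ p = (z @ x @ [a]) @ p" by simp
  then have "y @ [b] = z @ x @ [a]" by (rule append_same_eq[THEN iffD1])
  then show False using \<open>a \<noteq> b\<close> by (metis append_assoc last_snoc)
qed

lemma suffix_split_extend: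
  assumes "suffix_split u v"
  shows "suffix_split (x @ u @ p) (y @ v @ p)"
proof -
  obtain x' y' a b q where "a \<noteq> b" "u = x' @ a # q" "v = y' @ b # q"
    using assms unfolding suffix_split_def by blast
  then show ?thesis
    using suffix_splitI[of a b "x @ x'" "q @ p" "y @ y'"] by simp
qed

text \<open>The images of the letters form a suffix code in the strong sense that any two of them
  differ at a position from the right that lies in both; this property is inherited by the iterates.\<close>

lemma suffix_split_subst_word:
  assumes "\<And>a b. a \<in> A \<Longrightarrow> b \<in> A \<Longrightarrow> a \<noteq> b \<Longrightarrow> suffix_split (s a) (s b)"
    and "set u \<subseteq> A" "set v \<subseteq> A" "suffix_split u v"
  shows "suffix_split (subst_word s u) (subst_word s v)"
proof -
  obtain x y a b p where "a \<noteq> b" "u = x @ a # p" "v = y @ b # p"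
    using assms(4) unfolding suffix_split_def by blast
  moreover from this have "suffix_split (s a) (s b)" using assms(1-3) by simp
  ultimately show ?thesis
    by (simp add: subst_word_Cons suffix_split_extend)
qed

locale lorenz_subst =
  fixes k r :: nat
  assumes k_gt: "k > 2 * r + 1" and r_ge: "r \<ge> 1"
begin

abbreviation \<zeta> :: "nat \<Rightarrow> nat list" where "\<zeta> \<equiv> zeta k r"

abbreviation Z :: "nat \<Rightarrow> nat \<Rightarrow> nat list" where "Z \<equiv> subst_iter \<zeta>"

lemma zeta_simps:
  "\<zeta> (Suc 0) = [3, 2]"
  "2 \<le> j \<Longrightarrow> j \<le> 2 * r \<Longrightarrow> \<zeta> j = [j + 2, 2]"
  "2 * r + 1 \<le> j \<Longrightarrow> j < k \<Longrightarrow> \<zeta> j = [1, j + 1]"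
  "\<zeta> k = [1]"
  using k_gt r_ge by (auto simp: zeta_def)

lemma letter_cases [consumes 1, case_names one low high last]:
  assumes "a \<in> {1..k}"
  obtains "a = 1" "\<zeta> a = [3, 2]"
    | "2 \<le> a" "a \<le> 2 * r" "\<zeta> a = [a + 2, 2]"
    | "2 * r + 1 \<le> a" "a < k" "\<zeta> a = [1, a + 1]"
    | "a = k" "\<zeta> a = [1]"
proof -
  consider "a = 1" | "2 \<le> a" "a \<le> 2 * r" | "2 * r + 1 \<le> a" "a < k" | "a = k"
    using assms by fastforce
  then show thesis using that zeta_simps by cases auto
qed

sublocale nonerasing_subst "{1..k}" \<zeta>
proof
  fix a assume "a \<in> {1..k}"
  then show "\<zeta> a \<noteq> []" "set (\<zeta> a) \<subseteq> {1..k}"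
    by (cases rule: letter_cases; use k_gt r_ge in auto)+
qed

section \<open>Factorisations of the iterates\<close>

lemma Z_one: "Z (Suc n) (Suc 0) = Z n 3 @ Z n 2"
  by (simp add: subst_iter_Suc zeta_simps)

lemma Z_low: "2 \<le> j \<Longrightarrow> j \<le> 2 * r \<Longrightarrow> Z (Suc n) j = Z n (j + 2) @ Z n 2"
  by (simp add: subst_iter_Suc zeta_simps)

lemma Z_high: "2 * r + 1 \<le> j \<Longrightarrow> j < k \<Longrightarrow> Z (Suc n) j = Z n 1 @ Z n (j + 1)"
  by (simp add: subst_iter_Suc zeta_simps)

lemma Z_last: "Z (Suc n) k = Z n 1"
  by (simp add: subst_iter_Suc zeta_simps)

text \<open>Each of \<open>i\<close> applications moves one step along the odd letters and sheds a
  \<open>2\<close> on the right; a \<open>2\<close> shed with \<open>t\<close> applications left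
  becomes \<open>Z t 2\<close>.\<close>

lemma Z_one_unroll:
  "i \<le> r \<Longrightarrow> Z (n + i) 1 = Z n (2 * i + 1) @ concat (map (\<lambda>t. Z t 2) [n..<n + i])"
proof (induction i arbitrary: n)
  case (Suc i)
  then have "Z (Suc n) (2 * i + 1) = Z n (2 * Suc i + 1) @ Z n 2"
    by (cases "i = 0") (simp_all add: Z_one Z_low)
  moreover have "[n..<n + Suc i] = n # [Suc n..<Suc n + i]"
    by (simp add: upt_conv_Cons del: upt_Suc)
  ultimately show ?case
    using Suc.IH[of "Suc n"] Suc.prems by (simp del: upt_Suc)
qed simp

lemma Z_two_unroll:
  "i \<le> r \<Longrightarrow> Z (n + i) 2 = Z n (2 * i + 2) @ concat (map (\<lambda>t. Z t 2) [n..<n + i])"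
proof (induction i arbitrary: n)
  case (Suc i)
  then have "Z (Suc n) (2 * i + 2) = Z n (2 * Suc i + 2) @ Z n 2"
    by (simp add: Z_low)
  moreover have "[n..<n + Suc i] = n # [Suc n..<Suc n + i]"
    by (simp add: upt_conv_Cons del: upt_Suc)
  ultimately show ?case
    using Suc.IH[of "Suc n"] Suc.prems by (simp del: upt_Suc)
qed (simp add: numeral_2_eq_2)

text \<open>Each application sheds a \<open>1\<close> on the left, and \<open>k\<close> finally
  turns into a last \<open>1\<close>, which makes \<open>k - j + 1\<close> factors. The bound on
  \<open>n\<close> keeps the exponents \<open>n - i\<close> free of truncation.\<close>

lemma Z_high_unroll:
  assumes "2 * r + 1 \<le> j" "j \<le> k"
  shows "n + j > k \<Longrightarrow> Z n j = concat (map (\<lambda>i. Z (n - i) 1) [1..<k - j + 2])"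
  using assms(2,1)
proof (induction arbitrary: n rule: inc_induct)
  case base
  then obtain m where "n = Suc m" by (cases n) auto
  then show ?case using Z_last[of m] by simp
next
  case (step j)
  then obtain m where m: "n = Suc m" by (cases n) auto
  have "Z n j = Z m 1 @ Z m (j + 1)"
    using step by (simp add: m Z_high)
  also have "Z m (j + 1) = concat (map (\<lambda>i. Z (m - i) 1) [1..<k - Suc j + 2])"
    using step.IH[of m] step.prems step.hyps m by simp
  also have "map (\<lambda>i. Z (m - i) 1) [1..<k - Suc j + 2] = map (\<lambda>i. Z (n - i) 1) (map Suc [1..<k - Suc j + 2])"
    by (simp add: m)
  also have "map Suc [1..<k - Suc j + 2] = [2..<k - j + 2]"
    using step.hyps unfolding map_Suc_upt by (simp add: numeral_2_eq_2 Suc_diff_Suc)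
  also have "Z m 1 @ concat (map (\<lambda>i. Z (n - i) 1) [2..<k - j + 2]) =
      concat (map (\<lambda>i. Z (n - i) 1) (1 # [2..<k - j + 2]))"
    by (simp add: m)
  also have "1 # [2..<k - j + 2] = [1..<k - j + 2]"
    by (simp add: upt_conv_Cons numeral_2_eq_2 del: upt_Suc)
  finally show ?case .
qed

text \<open>The \<open>r\<close> steps from \<open>1\<close> to \<open>2 * r + 1\<close> give the
  factors on the right, and the climb from there to \<open>k\<close> gives those on the left. For
  the letter \<open>2\<close> the climb starts at \<open>2 * r + 2\<close>, hence one factor
  fewer.\<close>

lemma Z_one_decomp:
  assumes "n \<ge> k"
  shows "Z n 1 = concat (map (\<lambda>i. Z (n - i) 1) [r + 1..<k - r + 1]) @
          concat (map (\<lambda>i. Z i 2) [n - r..<n])"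
proof -
  have "Z (n - r) (2 * r + 1) =
      concat (map (\<lambda>i. Z (n - r - i) 1) [1..<k - (2 * r + 1) + 2])"
    using assms k_gt by (intro Z_high_unroll) auto
  also have "\<dots> = concat (map (\<lambda>i. Z (n - i) 1) [r + 1..<k - r + 1])"
    unfolding map_diff_upt_shift[of "\<lambda>i. Z i 1"] using k_gt
    by (intro arg_cong[of _ _ concat] map_cong arg_cong2[of _ _ _ _ upt]) auto
  finally show ?thesis
    using Z_one_unroll[of r "n - r"] assms k_gt by simp
qed

lemma Z_two_decomp:
  assumes "n \<ge> k"
  shows "Z n 2 = concat (map (\<lambda>i. Z (n - i) 1) [r + 1..<k - r]) @
          concat (map (\<lambda>i. Z i 2) [n - r..<n])"
proof -
  have "Z (n - r) (2 * r + 2) =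
      concat (map (\<lambda>i. Z (n - r - i) 1) [1..<k - (2 * r + 2) + 2])"
    using assms k_gt by (intro Z_high_unroll) auto
  also have "\<dots> = concat (map (\<lambda>i. Z (n - i) 1) [r + 1..<k - r])"
    unfolding map_diff_upt_shift[of "\<lambda>i. Z i 1"] using k_gt
    by (intro arg_cong[of _ _ concat] map_cong arg_cong2[of _ _ _ _ upt]) auto
  finally show ?thesis
    using Z_two_unroll[of r "n - r"] assms k_gt by simp
qed

text \<open>The last letter of an image is \<open>2\<close>, \<open>a + 1\<close> or
  \<open>1\<close>, for \<open>a\<close> at most \<open>2 * r\<close>, strictly between
  \<open>2 * r\<close> and \<open>k\<close>, or equal to \<open>k\<close>. This separates all pairs
  except two letters at most \<open>2 * r\<close>, whose images differ just before the final
  \<open>2\<close>.\<close>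

lemma suffix_split_zeta:
  assumes "a \<in> {1..k}" "b \<in> {1..k}" "a \<noteq> b"
  shows "suffix_split (\<zeta> a) (\<zeta> b)"
proof -
  have last: "\<exists>x c. \<zeta> a = x @ [c] \<and> c = (if a \<le> 2 * r then 2 else if a < k then a + 1 else 1)"
    if "a \<in> {1..k}" for a
    using that by (cases rule: letter_cases) (use k_gt r_ge in auto)
  show ?thesis
  proof (cases "a \<le> 2 * r \<and> b \<le> 2 * r")
    case True
    define f where "f a = (if a = 1 then 3 else a + 2)" for a :: nat
    have "\<zeta> a = [] @ f a # [2]" "\<zeta> b = [] @ f b # [2]"
      using True assms zeta_simps by (auto simp: f_def)
    moreover have "f a \<noteq> f b" using assms by (auto simp: f_def)
    ultimately show ?thesis using suffix_splitI[of "f a" "f b" "[]" "[2]" "[]"] by simp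
  next
    case False
    obtain x c where x: "\<zeta> a = x @ [c]"
      and c: "c = (if a \<le> 2 * r then 2 else if a < k then a + 1 else 1)"
      using last[OF assms(1)] by blast
    obtain y d where y: "\<zeta> b = y @ [d]"
      and d: "d = (if b \<le> 2 * r then 2 else if b < k then b + 1 else 1)"
      using last[OF assms(2)] by blast
    have "c \<noteq> d" using False assms c d r_ge by auto
    then show ?thesis unfolding x y by (rule suffix_splitI)
  qed
qed

lemma suffix_split_funpow:
  "set u \<subseteq> {1..k} \<Longrightarrow> set v \<subseteq> {1..k} \<Longrightarrow> suffix_split u v \<Longrightarrow>
    suffix_split ((subst_word \<zeta> ^^ n) u) ((subst_word \<zeta> ^^ n) v)"
proof (induction n arbitrary: u v)
  case (Suc n)
  then have "suffix_split (subst_word \<zeta> u) (subst_word \<zeta> v)"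
    using suffix_split_zeta by (intro suffix_split_subst_word[of "{1..k}"]) auto
  then show ?case
    using Suc.IH[of "subst_word \<zeta> u" "subst_word \<zeta> v"] Suc.prems subst_word_letters
    by (simp add: funpow_swap1)
qed simp

text \<open>The letter \<open>2\<close> is mapped to \<open>4 2\<close>, so a final \<open>2\<close>
  persists.\<close>

lemma Z_one_ends_with_two: "\<exists>x. Z (Suc n) 1 = x @ [2]"
proof (induction n)
  case 0
  show ?case by (simp add: Z_one)
next
  case (Suc n)
  then obtain x where "Z (Suc n) 1 = x @ [2]" by blast
  then show ?case
    using zeta_simps(2)[of 2] r_ge by (subst subst_iter_Suc') (simp add: subst_word_Cons)
qed

text \<open>Both words are images under the \<open>j\<close>-th iterate, of \<open>[1]\<close> and
  of a word ending in \<open>2\<close>; these two split at their last letters, and the split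
  survives the iteration.\<close>

lemma Z_one_not_suffix:
  assumes "j < n"
  shows "\<not> suffix (Z j 1) (Z n 1)"
proof -
  obtain d where n: "n = j + Suc d" using assms less_imp_Suc_add by force
  obtain x where x: "Z (Suc d) 1 = x @ [2]" using Z_one_ends_with_two by blast
  have "suffix_split [1] (Z (Suc d) 1)"
    using suffix_splitI[of 1 2 "[]" "[]" x] x by simp
  then have "suffix_split ((subst_word \<zeta> ^^ j) [1]) ((subst_word \<zeta> ^^ j) (Z (Suc d) 1))"
    using subst_iter_letters[of 1 "Suc d"] k_gt by (intro suffix_split_funpow) auto
  then show ?thesis
    unfolding n subst_iter_add by (simp add: subst_iter_def suffix_split_not_suffix)
qed

lemma Z_one_indecomposable:
  assumes "set js \<subseteq> {..<n}"
  shows "Z n 1 \<noteq> concat (map (\<lambda>j. Z j 1) js)"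
proof
  assume eq: "Z n 1 = concat (map (\<lambda>j. Z j 1) js)"
  show False
  proof (cases js rule: rev_cases)
    case Nil
    then show ?thesis using eq subst_iter_nonempty[of 1 n] k_gt by simp
  next
    case (snoc js' j)
    then have "suffix (Z j 1) (Z n 1)" using eq by (simp add: suffix_def)
    then show ?thesis using Z_one_not_suffix[of j n] assms snoc by simp
  qed
qed

end

section \<open>Periodic points and return times\<close>

lemma funpow_fixed: "f x = x \<Longrightarrow> (f ^^ n) x = x"
  by (induction n) simp_all

context lorenz_subst
begin

section \<open>Dynamics of first letters\<close>

lemma first_one: "first (Suc 0) = 3"
  by (simp add: zeta_simps)

lemma first_low: "2 \<le> a \<Longrightarrow> a \<le> 2 * r \<Longrightarrow> first a = a + 2"
  by (simp add: zeta_simps)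

lemma first_high: "2 * r + 1 \<le> a \<Longrightarrow> a \<le> k \<Longrightarrow> first a = 1"
  by (cases "a = k") (simp_all add: zeta_simps)

text \<open>Indexing the cycle by all natural numbers modulo \<open>r + 1\<close> turns
  \<open>first\<close> into \<open>Suc\<close> on indices, without a separate case for the
  wraparound.\<close>

definition cycle_letter :: "nat \<Rightarrow> nat" where
  "cycle_letter i = 2 * (i mod (r + 1)) + 1"

lemma cycle_letter_in: "cycle_letter i \<in> {1..k}"
proof -
  have "i mod (r + 1) < r + 1" by (rule mod_less_divisor) simp
  then show ?thesis using k_gt unfolding cycle_letter_def by (simp del: mod_less_divisor)
qed

lemma first_cycle_letter: "first (cycle_letter i) = cycle_letter (Suc i)"
proof -
  define j where "j = i mod (r + 1)"
  have j: "j \<le> r" using mod_less_divisor[of "r + 1" i] by (simp add: j_def)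
  have "Suc i mod (r + 1) = Suc j mod (r + 1)" by (simp add: j_def mod_Suc_eq)
  moreover have "first (2 * j + 1) = (if j = r then 1 else 2 * Suc j + 1)"
    using j k_gt first_one first_low[of "2 * j + 1"] first_high[of "2 * r + 1"] r_ge
    by (cases "j = 0") auto
  ultimately show ?thesis using j unfolding cycle_letter_def j_def[symmetric] by simp
qed

lemma funpow_first_cycle_letter: "(first ^^ n) (cycle_letter i) = cycle_letter (n + i)"
  by (induction n) (simp_all add: first_cycle_letter)

lemma cycle_letter_add [simp]: "cycle_letter (m * (r + 1) + i) = cycle_letter i"
  by (simp only: cycle_letter_def mod_mult_self3)

lemma cycle_letter_inj: "i \<le> r \<Longrightarrow> j \<le> r \<Longrightarrow> cycle_letter i = cycle_letter j \<longleftrightarrow> i = j"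
  by (simp add: cycle_letter_def)

lemma cycle_letter_less: "i \<le> r \<Longrightarrow> cycle_letter i = 2 * i + 1"
  by (simp add: cycle_letter_def)

lemma cycle_letter_Suc_r: "cycle_letter (Suc r) = 1"
  by (simp add: cycle_letter_def)

text \<open>Letters from \<open>2\<close> to \<open>2 * r\<close> climb by two until they exceed
  \<open>2 * r\<close>, and from there \<open>first\<close> leads to \<open>1\<close>.\<close>

lemma first_eventually_cycle:
  assumes "a \<in> {1..k}"
  shows "\<exists>N i. (first ^^ N) a = cycle_letter i"
  using assms
proof (induction "k - a" arbitrary: a rule: less_induct)
  case less
  consider "a = 1" | "2 \<le> a" "a \<le> 2 * r" | "2 * r + 1 \<le> a" "a \<le> k"
    using less.prems by fastforce
  then show ?case
  proof cases
    case 1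
    then have "(first ^^ 0) a = cycle_letter 0" by (simp add: cycle_letter_def)
    then show ?thesis by blast
  next
    case 2
    have "\<exists>N i. (first ^^ N) (a + 2) = cycle_letter i"
      using 2 k_gt by (intro less.hyps) auto
    then obtain N i where "(first ^^ N) (first a) = cycle_letter i"
      using 2 first_low by auto
    then have "(first ^^ Suc N) a = cycle_letter i" by (simp add: funpow_Suc_right del: funpow.simps)
    then show ?thesis by blast
  next
    case 3
    then have "(first ^^ 1) a = cycle_letter 0" by (simp add: first_high cycle_letter_def)
    then show ?thesis by blast
  qed
qed

text \<open>The orbit of \<open>a\<close> enters the cycle at time \<open>N\<close>, cannot leave
  it, and is back at \<open>a\<close> at the later or equal time \<open>m * N\<close>.\<close>

lemma periodic_letter_cycle:
  assumes "a \<in> {1..k}" "m \<ge> 1" "(first ^^ m) a = a"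
  shows "\<exists>i. a = cycle_letter i"
proof -
  obtain N i where N: "(first ^^ N) a = cycle_letter i"
    using first_eventually_cycle[OF assms(1)] by blast
  have "((first ^^ m) ^^ N) a = a" by (rule funpow_fixed[of "first ^^ m", OF assms(3)])
  then have "a = (first ^^ (m * N)) a" by (simp add: funpow_mult)
  also have "m * N = (m * N - N) + N" using assms(2) by (simp add: mult_le_mono1)
  also have "(first ^^ \<dots>) a = (first ^^ (m * N - N)) ((first ^^ N) a)"
    unfolding funpow_add by simp
  finally show ?thesis unfolding N funpow_first_cycle_letter by blast
qed

text \<open>Only \<open>k\<close> has an image of length one, and its second image is \<open>3 2\<close>.\<close>

lemma length_subst_word_twice:
  assumes "set w \<subseteq> {1..k}"
  shows "2 * length w \<le> length (subst_word \<zeta> (subst_word \<zeta> w))"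
  using assms
proof (induction w)
  case (Cons a w)
  then have a: "a \<in> {1..k}" by simp
  have "2 \<le> length (subst_word \<zeta> (\<zeta> a))"
  proof (cases "a = k")
    case True
    then show ?thesis by (simp add: zeta_simps subst_word_Cons)
  next
    case False
    with a have "length (\<zeta> a) = 2" by (cases rule: letter_cases) auto
    then show ?thesis using length_subst_word_ge[of "\<zeta> a"] closed[OF a] by simp
  qed
  with Cons show ?case by (simp add: subst_word_Cons)
qed simp

lemma length_Z_ge:
  assumes "a \<in> {1..k}"
  shows "n < length (Z (2 * n) a)"
proof (induction n)
  case (Suc n)
  have "2 * length (Z (2 * n) a) \<le> length (Z (Suc (Suc (2 * n))) a)"
    using length_subst_word_twice[OF subst_iter_letters[OF assms]] by (simp add: subst_iter_Suc')
  with Suc show ?case by simp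
qed simp

lemma length_Z_ge':
  assumes "a \<in> {1..k}" "2 * n \<le> m"
  shows "n < length (Z m a)"
  using length_Z_ge[OF assms(1), of n] length_subst_iter_mono[OF assms] by simp

lemma length_Z_filterlim:
  assumes "a \<in> {1..k}" "d \<ge> 1"
  shows "filterlim (\<lambda>m. length (Z (m * d) a)) at_top sequentially"
  unfolding filterlim_at_top
proof
  fix n
  have "n \<le> length (Z (m * d) a)" if "m \<ge> 2 * n" for m
  proof -
    have "2 * n \<le> m * d" using that assms(2) by (metis le_trans mult_le_mono2 mult.right_neutral)
    then show ?thesis using length_Z_ge'[OF assms(1)] by (simp add: less_imp_le)
  qed
  then show "\<forall>\<^sub>F m in sequentially. n \<le> length (Z (m * d) a)"
    unfolding eventually_sequentially by blast
qed

section \<open>Limit words along the cycle of first letters\<close>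

lemma Z_cycle_step: "\<exists>w. Z (Suc n) (cycle_letter i) = Z n (cycle_letter (Suc i)) @ w"
proof -
  have "\<zeta> (cycle_letter i) = cycle_letter (Suc i) # tl (\<zeta> (cycle_letter i))"
    using nonempty[OF cycle_letter_in, of i] first_cycle_letter[of i]
    by (metis list.collapse)
  then show ?thesis unfolding subst_iter_Suc by (metis concat.simps(2) list.simps(9))
qed

lemma Z_cycle_prefix: "\<exists>w. Z (m + n) (cycle_letter i) = Z n (cycle_letter (m + i)) @ w"
proof (induction m arbitrary: i)
  case (Suc m)
  obtain w where w: "Z (m + n) (cycle_letter (Suc i)) = Z n (cycle_letter (m + Suc i)) @ w"
    using Suc by blast
  obtain w' where "Z (Suc (m + n)) (cycle_letter i) = Z (m + n) (cycle_letter (Suc i)) @ w'"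
    using Z_cycle_step by blast
  then show ?case using w by simp
qed simp

lemma ex_cycle_limit: "\<exists>v. is_word_limit (\<lambda>m. Z (m * (r + 1)) (cycle_letter i)) v"
proof (rule ex_word_limit)
  fix m
  \<comment> \<open>After \<open>r + 1\<close> applications the first letter is back where it
    started, so the words are nested as prefixes.\<close>
  obtain w where "Z ((r + 1) + m * (r + 1)) (cycle_letter i) =
      Z (m * (r + 1)) (cycle_letter ((r + 1) + i)) @ w"
    using Z_cycle_prefix by blast
  moreover have "cycle_letter ((r + 1) + i) = cycle_letter i"
    using cycle_letter_add[of 1 i] by (simp only: mult_1)
  ultimately show "prefix (Z (m * (r + 1)) (cycle_letter i)) (Z (Suc m * (r + 1)) (cycle_letter i))"
    by (simp only: mult_Suc prefixI)
next
  show "filterlim (\<lambda>m. length (Z (m * (r + 1)) (cycle_letter i))) at_top sequentially"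
    by (rule length_Z_filterlim[OF cycle_letter_in]) simp
qed

definition cycle_limit :: "nat \<Rightarrow> nat stream" where
  "cycle_limit i = (SOME v. is_word_limit (\<lambda>m. Z (m * (r + 1)) (cycle_letter i)) v)"

lemma is_word_limit_cycle_limit:
  "is_word_limit (\<lambda>m. Z (m * (r + 1)) (cycle_letter i)) (cycle_limit i)"
  unfolding cycle_limit_def using ex_cycle_limit by (rule someI_ex)

lemma cycle_limit_shift: "\<exists>v. cycle_limit i = Z (m * (r + 1)) (cycle_letter i) @- v"
  using is_word_limit_cycle_limit[of i] unfolding is_word_limit_def stake_length_eq_iff by blast

text \<open>The words \<open>Z (M * (r + 1)) (cycle_letter i)\<close> grow without bound, so sharing
  them for arbitrarily large \<open>M\<close> determines the stream.\<close>

lemma cycle_limit_eqI: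
  assumes "\<And>m. \<exists>M v'. m \<le> M \<and> v = Z (M * (r + 1)) (cycle_letter i) @- v'"
  shows "v = cycle_limit i"
proof (rule stream_eqI_prefixes)
  fix n
  \<comment> \<open>The factor 2 appears because lengths are only known to double every second
    application.\<close>
  obtain M v' where M: "2 * n \<le> M" "v = Z (M * (r + 1)) (cycle_letter i) @- v'"
    using assms by blast
  obtain v'' where "cycle_limit i = Z (M * (r + 1)) (cycle_letter i) @- v''"
    using cycle_limit_shift by blast
  moreover have "n \<le> length (Z (M * (r + 1)) (cycle_letter i))"
    using M(1) length_Z_ge'[OF cycle_letter_in, of n "M * (r + 1)" i] by simp
  ultimately show "\<exists>w s s'. n \<le> length w \<and> v = w @- s \<and> cycle_limit i = w @- s'"
    using M(2) by blast
qed

lemma cycle_limit_in_streams: "cycle_limit i \<in> streams {1..k}"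
  unfolding streams_iff_snth
proof
  fix n
  obtain v where v: "cycle_limit i = Z ((2 * n) * (r + 1)) (cycle_letter i) @- v"
    using cycle_limit_shift by blast
  have n: "n < length (Z ((2 * n) * (r + 1)) (cycle_letter i))"
    by (rule length_Z_ge'[OF cycle_letter_in]) simp
  then have "cycle_limit i !! n = Z ((2 * n) * (r + 1)) (cycle_letter i) ! n"
    unfolding v by (rule shift_snth_less)
  also have "\<dots> \<in> {1..k}"
    using subst_iter_letters[OF cycle_letter_in] nth_mem[OF n] by blast
  finally show "cycle_limit i !! n \<in> {1..k}" .
qed

lemma shd_cycle_limit: "shd (cycle_limit i) = cycle_letter i"
proof -
  obtain v where "cycle_limit i = Z (0 * (r + 1)) (cycle_letter i) @- v"
    using cycle_limit_shift by blast
  then show ?thesis by simp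
qed

text \<open>Applying the substitution to a prefix adds one iteration, and the longer iterate begins
  with the same iterate of the next cycle letter.\<close>

lemma subst_stream_cycle_limit: "subst_stream \<zeta> (cycle_limit i) = cycle_limit (Suc i)"
proof (rule cycle_limit_eqI)
  fix m
  obtain v where v: "cycle_limit i = Z (m * (r + 1)) (cycle_letter i) @- v"
    using cycle_limit_shift by blast
  have "subst_stream \<zeta> (cycle_limit i) = Z (Suc (m * (r + 1))) (cycle_letter i) @- subst_stream \<zeta> v"
    unfolding v by (simp only: subst_iter_Suc' subst_stream_shift[OF subst_iter_letters[OF cycle_letter_in]])
  moreover obtain w where
    "Z (Suc (m * (r + 1))) (cycle_letter i) = Z (m * (r + 1)) (cycle_letter (Suc i)) @ w"
    using Z_cycle_step by blast
  ultimately have "subst_stream \<zeta> (cycle_limit i) =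
      Z (m * (r + 1)) (cycle_letter (Suc i)) @- (w @- subst_stream \<zeta> v)"
    by (simp only: shift_append)
  then show "\<exists>M v'. m \<le> M \<and> subst_stream \<zeta> (cycle_limit i) = Z (M * (r + 1)) (cycle_letter (Suc i)) @- v'"
    by blast
qed

lemma funpow_subst_stream_cycle_limit: "(subst_stream \<zeta> ^^ n) (cycle_limit i) = cycle_limit (n + i)"
  by (induction n) (simp_all add: subst_stream_cycle_limit)

lemma cycle_limit_cong: "cycle_letter i = cycle_letter j \<Longrightarrow> cycle_limit i = cycle_limit j"
  by (simp add: cycle_limit_def)

lemma cycle_limit_periodic: "cycle_limit i \<in> periodic_points k \<zeta>"
proof -
  have "(subst_stream \<zeta> ^^ (r + 1)) (cycle_limit i) = cycle_limit i"
    unfolding funpow_subst_stream_cycle_limit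
    using cycle_letter_add[of 1 i] by (intro cycle_limit_cong) (simp only: mult_1)
  then show ?thesis
    unfolding periodic_points_def using cycle_limit_in_streams
    by (auto intro!: exI[of _ "r + 1"])
qed

lemma shd_in: "v \<in> streams A \<Longrightarrow> shd v \<in> A"
  by (auto simp: streams_iff_snth dest: spec[of _ 0])

lemma periodic_pointD:
  assumes "v \<in> periodic_points k \<zeta>"
  shows "\<exists>i. v = cycle_limit i"
proof -
  obtain m where v: "v \<in> streams {1..k}" and m: "m \<ge> 1" "(subst_stream \<zeta> ^^ m) v = v"
    using assms unfolding periodic_points_def by blast
  have "(first ^^ m) (shd v) = shd v"
    using shd_funpow_subst_stream[OF shd_in[OF v], of m] m(2) by simp
  then obtain i where i: "shd v = cycle_letter i"
    using periodic_letter_cycle[OF shd_in[OF v] m(1)] by blast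
  have "v = cycle_limit i"
  proof (rule cycle_limit_eqI)
    fix n
    \<comment> \<open>A common multiple of the period \<open>m\<close> and of \<open>r + 1\<close>
      is used, so that \<open>v\<close> is fixed and begins with one of the words defining the
      limit.\<close>
    have "((subst_stream \<zeta> ^^ m) ^^ (n * (r + 1))) v = v"
      by (rule funpow_fixed[of "subst_stream \<zeta> ^^ m", OF m(2)])
    then have "v = (subst_stream \<zeta> ^^ (m * n * (r + 1))) v"
      by (simp only: funpow_mult mult.assoc)
    also have "\<dots> = (subst_stream \<zeta> ^^ (m * n * (r + 1))) (cycle_letter i ## stl v)"
      by (simp only: i[symmetric] stream.collapse)
    also have "\<dots> = Z (m * n * (r + 1)) (cycle_letter i) @- (subst_stream \<zeta> ^^ (m * n * (r + 1))) (stl v)"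
      by (rule funpow_subst_stream_shift[OF cycle_letter_in])
    finally show "\<exists>M v'. n \<le> M \<and> v = Z (M * (r + 1)) (cycle_letter i) @- v'"
      using m(1) by (intro exI[of _ "m * n"]) auto
  qed
  then show ?thesis ..
qed

text \<open>A fixed point would begin with a letter fixed by \<open>first\<close>, and no letter
  is.\<close>

lemma fixed_points_empty: "fixed_points k \<zeta> = {}"
proof -
  have "first a \<noteq> a" if "a \<in> {1..k}" for a
    using that by (cases rule: letter_cases) (use k_gt r_ge in auto)
  moreover have "first (shd v) = shd v" if "v \<in> streams {1..k}" "subst_stream \<zeta> v = v" for v
    using shd_funpow_subst_stream[OF shd_in[OF that(1)], of 1] that(2) by simp
  ultimately show ?thesis
    unfolding fixed_points_def using shd_in by blast
qed

lemma periodic_points_eq: "periodic_points k \<zeta> = (\<lambda>j. cycle_limit (j - 1)) ` {1..r + 1}"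
proof -
  have "cycle_limit i \<in> (\<lambda>j. cycle_limit (j - 1)) ` {1..r + 1}" for i
  proof
    show "cycle_limit i = cycle_limit (Suc (i mod (r + 1)) - 1)"
      by (rule cycle_limit_cong) (simp add: cycle_letter_def)
    show "Suc (i mod (r + 1)) \<in> {1..r + 1}" by (simp add: Suc_le_eq)
  qed
  then show ?thesis using cycle_limit_periodic periodic_pointD by blast
qed

section \<open>Return times in the graph\<close>

abbreviation graph :: "(nat \<times> nat) set" where "graph \<equiv> subst_graph k \<zeta>"

lemma graph_low:
  assumes "(a, b) \<in> graph" "a \<le> 2 * r"
  shows "2 \<le> b" "b \<le> a + 2"
proof -
  have "a \<in> {1..k}" "b \<in> set (\<zeta> a)" using assms(1) by (auto simp: subst_graph_def)
  then have "2 \<le> b \<and> b \<le> a + 2"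
    by (cases rule: letter_cases) (use assms(2) k_gt r_ge in auto)
  then show "2 \<le> b" "b \<le> a + 2" by auto
qed

text \<open>The upper bound keeps each letter before the last step at most \<open>2 * r\<close>, so
  that \<open>graph_low\<close> applies again; the lower bound excludes an early return to
  \<open>1\<close>.\<close>

lemma graph_path_bounds:
  "1 \<le> n \<Longrightarrow> n \<le> r \<Longrightarrow> (1, b) \<in> graph ^^ n \<Longrightarrow> 2 \<le> b \<and> b \<le> 2 * n + 1"
proof (induction n arbitrary: b rule: nat_induct_at_least)
  case base
  then show ?case using graph_low[of 1 b] by auto
next
  case (Suc n)
  then obtain a where a: "(1, a) \<in> graph ^^ n" "(a, b) \<in> graph" by auto
  then have "2 \<le> a \<and> a \<le> 2 * n + 1" using Suc by simp
  then show ?case using graph_low[OF a(2)] Suc.prems by auto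
qed

lemma graph_return_ge: "1 \<le> n \<Longrightarrow> (1, 1) \<in> graph ^^ n \<Longrightarrow> r + 1 \<le> n"
  using graph_path_bounds[of n 1] by (cases "n \<le> r") auto

lemma cycle_in_graph: "(1, cycle_letter n) \<in> graph ^^ n"
proof (induction n)
  case 0
  show ?case by (simp add: cycle_letter_def)
next
  case (Suc n)
  have "(cycle_letter n, cycle_letter (Suc n)) \<in> graph"
    using cycle_letter_in[of n] nonempty[OF cycle_letter_in, of n]
    by (auto simp: subst_graph_def simp flip: first_cycle_letter)
  with Suc show ?case by auto
qed

lemma vertex_return_time_one: "vertex_return_time graph 1 = enat (r + 1)"
  unfolding vertex_return_time_def
proof (rule Inf_enat_eqI)
  show "1 \<le> r + 1 \<and> (1, 1) \<in> graph ^^ (r + 1)"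
    using cycle_in_graph[of "Suc r"] by (simp only: cycle_letter_Suc_r) simp
qed (use graph_return_ge in auto)

section \<open>Substitutions with the same graph\<close>

context
  fixes \<eta> :: "nat \<Rightarrow> nat list"
  assumes same_graph: "subst_graph k \<eta> = graph"
begin

lemma same_graph_set: "a \<in> {1..k} \<Longrightarrow> set (\<eta> a) = set (\<zeta> a)"
  using same_graph unfolding subst_graph_def by blast

interpretation other: nonerasing_subst "{1..k}" \<eta>
proof
  fix a assume a: "a \<in> {1..k}"
  then show "\<eta> a \<noteq> []" "set (\<eta> a) \<subseteq> {1..k}"
    using same_graph_set[OF a] nonempty[OF a] closed[OF a] by auto
qed

lemma one_in: "1 \<in> {1..k}"
  using k_gt by simp

lemma prefix_iter_iff: "prefix [1] (subst_iter \<eta> n 1) \<longleftrightarrow> (other.first ^^ n) 1 = 1"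
  using other.subst_iter_hd[OF one_in, of n] other.subst_iter_nonempty[OF one_in, of n]
  by (cases "subst_iter \<eta> n 1") (auto simp: prefix_Cons)

lemma other_first_edge:
  assumes "a \<in> {1..k}"
  shows "(a, other.first a) \<in> graph"
  using assms other.nonempty[OF assms] unfolding same_graph[symmetric]
  by (simp add: subst_graph_def)

text \<open>This transfers the lower bound on returns in the graph to every substitution that shares
  it.\<close>

lemma other_orbit_path: "(1, (other.first ^^ n) 1) \<in> graph ^^ n"
proof (induction n)
  case (Suc n)
  then show ?case
    using other_first_edge[OF other.funpow_first_in[OF one_in, of n]] by auto
qed simp

text \<open>A return to \<open>1\<close> after \<open>r + 1\<close> steps has no slack: the first
  letters must climb by exactly two each time, hence run through the cycle.\<close>

lemma other_return_iff:
  "(other.first ^^ (r + 1)) 1 = 1 \<longleftrightarrow> (\<forall>i\<le>r. other.first (cycle_letter i) = first (cycle_letter i))"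
proof
  assume same: "\<forall>i\<le>r. other.first (cycle_letter i) = first (cycle_letter i)"
  have "(other.first ^^ n) 1 = cycle_letter n" if "n \<le> r + 1" for n
    using that
  proof (induction n)
    case 0
    show ?case by (simp add: cycle_letter_def)
  next
    case (Suc n)
    then show ?case using same by (simp add: first_cycle_letter)
  qed
  from this[of "r + 1"] show "(other.first ^^ (r + 1)) 1 = 1"
    using cycle_letter_Suc_r by simp
next
  define x where "x n = (other.first ^^ n) 1" for n
  assume "(other.first ^^ (r + 1)) 1 = 1"
  then have ret: "x (Suc r) = 1" by (simp add: x_def)
  have edge: "(x n, x (Suc n)) \<in> graph" for n
    using other_first_edge[OF other.funpow_first_in[OF one_in, of n]] by (simp add: x_def)
  have le: "x n \<le> 2 * n + 1" if "n \<le> r" for n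
  proof (cases "n = 0")
    case False
    then show ?thesis
      using graph_path_bounds[of n "x n"] other_orbit_path[of n] that by (simp add: x_def)
  qed (simp add: x_def)
  \<comment> \<open>Downward from \<open>r\<close>: the edge to \<open>1\<close> forces
    \<open>x r\<close> above \<open>2 * r\<close>, and each earlier step gains at most two.\<close>
  have "2 * n + 1 \<le> x n" if "n \<le> r" for n
    using that
  proof (induction n rule: inc_induct)
    case base
    show ?case using graph_low(1)[OF edge, of r] ret by (cases "x r \<le> 2 * r") auto
  next
    case (step n)
    then show ?case using graph_low(2)[OF edge, of n] le[of n] by auto
  qed
  then have x: "x n = cycle_letter n" if "n \<le> r" for n
    using le[OF that] that by (simp add: cycle_letter_less antisym)
  have "x (Suc n) = cycle_letter (Suc n)" if "n \<le> r" for n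
    using that x[of "Suc n"] ret cycle_letter_Suc_r by (cases "n = r") auto
  then show "\<forall>i\<le>r. other.first (cycle_letter i) = first (cycle_letter i)"
    using x by (simp add: x_def first_cycle_letter)
qed

lemma other_symbol_return_time_ge: "enat (r + 1) \<le> symbol_return_time \<eta> 1"
  unfolding symbol_return_time_def
proof (rule Inf_greatest)
  fix t assume "t \<in> {enat n |n. 1 \<le> n \<and> prefix [1] (subst_iter \<eta> n 1)}"
  then obtain n where "t = enat n" "1 \<le> n" "(other.first ^^ n) 1 = 1"
    unfolding prefix_iter_iff by blast
  then show "enat (r + 1) \<le> t"
    using graph_return_ge[of n] other_orbit_path[of n] by simp
qed

lemma other_symbol_return_time_gt_iff:
  "enat (r + 1) < symbol_return_time \<eta> 1 \<longleftrightarrow>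
    (\<exists>i\<in>{1..r + 1}. hd (\<eta> (2 * i - 1)) \<noteq> hd (\<zeta> (2 * i - 1)))"
proof -
  have "symbol_return_time \<eta> 1 \<le> enat (r + 1) \<longleftrightarrow>
      (\<exists>n\<le>r + 1. 1 \<le> n \<and> (other.first ^^ n) 1 = 1)"
    unfolding symbol_return_time_def Inf_enat_le_iff prefix_iter_iff ..
  \<comment> \<open>Returns in fewer than \<open>r + 1\<close> steps are already excluded by the
    graph.\<close>
  also have "\<dots> \<longleftrightarrow> (other.first ^^ (r + 1)) 1 = 1"
  proof
    assume "\<exists>n\<le>r + 1. 1 \<le> n \<and> (other.first ^^ n) 1 = 1"
    then obtain n where n: "n \<le> r + 1" "1 \<le> n" "(other.first ^^ n) 1 = 1" by blast
    then have "r + 1 \<le> n" using graph_return_ge[of n] other_orbit_path[of n] by simp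
    then have "n = r + 1" using n(1) by simp
    then show "(other.first ^^ (r + 1)) 1 = 1" using n(3) by simp
  qed auto
  also have "\<dots> \<longleftrightarrow> (\<forall>i\<in>{1..r + 1}. hd (\<eta> (2 * i - 1)) = hd (\<zeta> (2 * i - 1)))"
  proof -
    have "{1..r + 1} = Suc ` {..r}" by (simp add: image_Suc_atMost)
    then show ?thesis unfolding other_return_iff by (auto simp: cycle_letter_less)
  qed
  finally show ?thesis by (simp flip: not_le)
qed

end

text \<open>The comparison is applied to the substitution itself, where no first letter
  differs.\<close>

lemma symbol_return_time_one: "symbol_return_time \<zeta> 1 = enat (r + 1)"
  using other_symbol_return_time_ge[OF refl] other_symbol_return_time_gt_iff[OF refl]
  by (simp add: antisym not_less[symmetric])

end

section \<open>Lengths\<close>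

context lorenz_subst
begin

text \<open>Index \<open>m\<close> stands for the exponent \<open>m - k\<close>. The values below
  \<open>k\<close> continue the lengths to negative exponents and are the initial values of
  \<open>lorenz_fib\<close>.\<close>

definition shifted_length :: "nat \<Rightarrow> int" where
  "shifted_length m =
    (if m < k - 1 then 0 else if m = k - 1 then 1 else int (length (Z (m - k) 1)))"

lemma shifted_length_add_k [simp]: "shifted_length (n + k) = int (length (Z n 1))"
  using k_gt by (auto simp: shifted_length_def)

lemma sum_shifted_length_initial:
  assumes "a < k"
  shows "(\<Sum>m = a..<k. shifted_length m) = 1"
proof -
  have "(\<Sum>m = a..<k. shifted_length m) = (\<Sum>m = a..<k. if m = k - 1 then 1 else 0)"
    by (rule sum.cong) (auto simp: shifted_length_def)
  then show ?thesis using assms by (simp add: sum.delta)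
qed

text \<open>The sum collects the letters \<open>1\<close> shed by
  \<open>j \<mapsto> 1 (j + 1)\<close>. The value 1 at index \<open>k - 1\<close> accounts for the
  letter that remains when \<open>n\<close> is too small to pass \<open>k\<close>.\<close>

lemma length_Z_high:
  "2 * r + 1 \<le> j \<Longrightarrow> j \<le> k \<Longrightarrow>
    int (length (Z n j)) = (\<Sum>m = n + j - 1..<n + k. shifted_length m)"
proof (induction n arbitrary: j)
  case 0
  then show ?case by (simp add: sum_shifted_length_initial)
next
  case (Suc n)
  show ?case
  proof (cases "j = k")
    case True
    then show ?thesis by (simp add: Z_last)
  next
    case False
    then have "int (length (Z (Suc n) j)) =
        shifted_length (n + k) + (\<Sum>m = n + j..<n + k. shifted_length m)"
      using Suc.IH[of "j + 1"] Suc.prems by (simp add: Z_high)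
    also have "\<dots> = (\<Sum>m = n + j..<Suc (n + k). shifted_length m)"
      using False Suc.prems by (subst sum.atLeastLessThan_Suc) auto
    finally show ?thesis by simp
  qed
qed

lemma length_concat_Z:
  "int (length (concat (map (\<lambda>t. Z t j) [a..<b]))) = (\<Sum>t = a..<b. int (length (Z t j)))"
  by (simp add: length_concat comp_def interv_sum_list_conv_sum_set_nat)

text \<open>After \<open>r\<close> steps the unrollings of \<open>1\<close> and \<open>2\<close>
  have the same right factors, and the lengths of their left factors differ by a single
  summand.\<close>

lemma length_Z_two: "int (length (Z n 2)) = shifted_length (n + k) - shifted_length (n + r)"
proof (cases "r \<le> n")
  case True
  then obtain m where n: "n = m + r" by (metis add.commute le_Suc_ex)
  have "int (length (Z n 1)) - int (length (Z n 2)) =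
      int (length (Z m (2 * r + 1))) - int (length (Z m (2 * r + 2)))"
    unfolding n Z_one_unroll[OF order_refl] Z_two_unroll[OF order_refl] by simp
  also have "\<dots> = (\<Sum>i = m + 2 * r..<m + k. shifted_length i)
      - (\<Sum>i = Suc (m + 2 * r)..<m + k. shifted_length i)"
    using k_gt by (simp add: length_Z_high)
  also have "\<dots> = shifted_length (m + 2 * r)"
    using k_gt by (simp add: sum.atLeast_Suc_lessThan)
  also have "m + 2 * r = n + r" by (simp add: n)
  finally show ?thesis by simp
next
  case False
  then have "length (Z n 1) = length (Z n 2)"
    using Z_one_unroll[of n 0] Z_two_unroll[of n 0] by simp
  moreover have "shifted_length (n + r) = 0"
    using False k_gt by (simp add: shifted_length_def)
  ultimately show ?thesis by simp
qed

lemma sum_shift: "(\<Sum>j = a..<b. f (n + j)) = (\<Sum>m = n + a..<n + b. f m)"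
  for f :: "nat \<Rightarrow> 'a :: comm_monoid_add"
  using sum.shift_bounds_nat_ivl[of f a n b] by (simp add: add.commute)

text \<open>Taking lengths in the unrolling of \<open>1\<close>, each factor \<open>Z t 2\<close>
  contributes a difference; the positive parts extend the sum from \<open>2 * r + 1\<close>, the
  negative parts form the subtracted sum.\<close>

lemma shifted_length_recurrence:
  "shifted_length (n + k) =
    (\<Sum>j = r..<k. shifted_length (n + j)) - (\<Sum>j<r. shifted_length (n + j))"
proof (cases "r \<le> n")
  case True
  then obtain m where n: "n = m + r" by (metis add.commute le_Suc_ex)
  let ?e = shifted_length
  have "?e (n + k) = int (length (Z m (2 * r + 1))) + (\<Sum>t = m..<m + r. int (length (Z t 2)))"
    unfolding n shifted_length_add_k Z_one_unroll[OF order_refl] length_append of_nat_add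
      length_concat_Z ..
  also have "\<dots> = sum ?e {m + 2 * r..<m + k} + (\<Sum>t = m..<m + r. ?e (k + t) - ?e (r + t))"
    using k_gt by (simp add: length_Z_high length_Z_two add.commute[of _ k] add.commute[of _ r])
  also have "\<dots> = sum ?e {m + 2 * r..<m + k} + sum ?e {m + k..<m + k + r} - sum ?e {m + r..<m + 2 * r}"
    unfolding sum_subtractf sum_shift by (simp add: mult_2 mult_2_right ac_simps)
  also have "sum ?e {m + 2 * r..<m + k} + sum ?e {m + k..<m + k + r} = sum ?e {m + 2 * r..<m + k + r}"
    using k_gt by (intro sum.atLeastLessThan_concat) auto
  also have "\<dots> = (\<Sum>j = r..<k. ?e (n + j))"
    unfolding sum_shift n by (simp add: mult_2 mult_2_right ac_simps)
  also have "sum ?e {m + r..<m + 2 * r} = (\<Sum>j<r. ?e (n + j))"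
    unfolding lessThan_atLeast0 sum_shift n by (simp add: mult_2 mult_2_right ac_simps)
  finally show ?thesis .
next
  case False
  let ?e = shifted_length
  have zero: "?e m = 0" if "m < k - 1" for m
    using that by (simp add: shifted_length_def)
  \<comment> \<open>For \<open>n < r\<close> the unrolling stops at the single letter
    \<open>2 * n + 1\<close>, which is the summand 1.\<close>
  have "?e (n + k) = 1 + (\<Sum>t = 0..<n. int (length (Z t 2)))"
    using Z_one_unroll[of n 0] False length_concat_Z[of 2 0 n] by simp
  also have "(\<Sum>t = 0..<n. int (length (Z t 2))) = (\<Sum>t = 0..<n. ?e (k + t))"
    using False k_gt zero by (intro sum.cong) (auto simp: length_Z_two add.commute[of _ k])
  also have "1 + \<dots> = sum ?e {n + r..<k} + sum ?e {k..<k + n}"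
    unfolding sum_shift using sum_shifted_length_initial[of "n + r"] False k_gt by simp
  also have "\<dots> = sum ?e {n + r..<k + n}"
    using False k_gt by (intro sum.atLeastLessThan_concat) auto
  also have "\<dots> = (\<Sum>j = r..<k. ?e (n + j))"
    unfolding sum_shift by (simp add: ac_simps)
  \<comment> \<open>All indices \<open>n + j\<close> stay below \<open>k - 1\<close>, so the
    subtracted sum is zero.\<close>
  also have "\<dots> = \<dots> - (\<Sum>j<r. ?e (n + j))"
    using False k_gt by (subst (2) sum.neutral) (auto intro: zero)
  finally show ?thesis .
qed

lemma lorenz_fib_eq_shifted_length: "lorenz_fib k r m = shifted_length m"
proof (induction m rule: less_induct)
  case (less m)
  show ?case
  proof (cases "m < k")
    case True
    then show ?thesis
      using k_gt by (subst lorenz_fib.simps) (auto simp: shifted_length_def)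
  next
    case False
    then obtain n where m: "m = n + k" by (metis add.commute le_Suc_ex not_less)
    have "lorenz_fib k r m = (\<Sum>j = r..<k. lorenz_fib k r (n + j)) - (\<Sum>j<r. lorenz_fib k r (n + j))"
      unfolding m using k_gt by (intro lorenz_fib_recurrence) simp
    also have "\<dots> = (\<Sum>j = r..<k. shifted_length (n + j)) - (\<Sum>j<r. shifted_length (n + j))"
      using k_gt by (intro arg_cong2[of _ _ _ _ minus] sum.cong less.IH) (auto simp: m)
    also have "\<dots> = shifted_length m"
      unfolding m by (rule shifted_length_recurrence[symmetric])
    finally show ?thesis .
  qed
qed

lemma lorenz_fib_eq_length: "lorenz_fib k r (n + k) = int (length (Z n 1))"
  by (simp add: lorenz_fib_eq_shifted_length)

end

section \<open>Characteristic polynomial\<close>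

lemma sum_power_shift:
  "(\<Sum>i = a + d..<b + d. x ^ i) = x ^ d * (\<Sum>i = a..<b. x ^ i)"
  for x :: "'a :: comm_semiring_1"
  unfolding sum.shift_bounds_nat_ivl by (simp add: sum_distrib_left power_add mult.commute)

text \<open>\<open>G\<close> and \<open>H\<close> stand for the two sums in the Lorenz polynomial.
  Writing all powers through \<open>x ^ r\<close> and \<open>x ^ d\<close> removes the subtractions
  in the exponents.\<close>

lemma elimination_identity:
  fixes x :: "'a :: comm_ring_1"
  assumes "k = r + 2 + d"
  shows "(x ^ (k + 1) * x ^ (k + 1) - x ^ (k + 1) * (x * G)
      + x ^ (r + 1) * (x ^ (k - r + 1) * H)) * x ^ (k - 2) = (x ^ k - G + H) * x ^ (2 * k)"
proof -
  define a b where "a = x ^ r" and "b = x ^ d"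
  have "x ^ (k + 1) = a * b * x * x * x" "x ^ (r + 1) = a * x" "x ^ (k - r + 1) = b * x * x * x"
    "x ^ (k - 2) = a * b" "x ^ k = a * b * x * x" "x ^ (2 * k) = a * b * x * x * (a * b * x * x)"
    by (simp_all add: assms a_def b_def power_add mult_2 mult_2_right ac_simps power2_eq_square)
  then show ?thesis by (simp only: algebra_simps)
qed

lemma det_2_by_2:
  fixes A :: "'a :: idom mat"
  assumes "A \<in> carrier_mat 2 2"
  shows "det A = A $$ (0, 0) * A $$ (1, 1) - A $$ (0, 1) * A $$ (1, 0)"
proof -
  define E where "E i j = mat 1 1 (\<lambda>_. A $$ (i, j))" for i j
  have E: "E i j \<in> carrier_mat 1 1" for i j by (simp add: E_def)
  have "A = four_block_mat (E 0 0) (E 0 1) (E 1 0) (E 1 1)"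
    using assms by (intro eq_matI) (auto simp: E_def less_Suc_eq)
  also have "det \<dots> = det (E 0 0 * E 1 1 - E 0 1 * E 1 0)"
    by (intro det_four_block_mat[OF E E E E] eq_matI) (auto simp: E_def scalar_prod_def)
  also have "\<dots> = A $$ (0, 0) * A $$ (1, 1) - A $$ (0, 1) * A $$ (1, 0)"
    by (subst det_single) (auto simp: E_def scalar_prod_def)
  finally show ?thesis .
qed

context lorenz_subst
begin

text \<open>The extreme letters need no clause of their own: \<open>1\<close> follows the rule of
  the low letters, and the missing successor of \<open>k\<close> would have index \<open>k\<close>,
  outside the range of \<open>i\<close>.\<close>

lemma count_zeta:
  assumes "i < k" "l < k"
  shows "count_list (\<zeta> (l + 1)) (i + 1) =
    (if i = 0 then of_bool (2 * r \<le> l)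
     else if i = 1 then of_bool (l < 2 * r)
     else of_bool (l + 2 = i \<and> l < 2 * r) + of_bool (l + 1 = i \<and> 2 * r \<le> l))"
proof -
  have "l + 1 \<in> {1..k}" using assms by simp
  then show ?thesis
    by (cases rule: letter_cases) (use assms k_gt r_ge in auto)
qed

abbreviation x :: "int poly" where "x \<equiv> [:0, 1:]"

lemma lorenz_poly_eq: "lorenz_poly k r = x ^ k - (\<Sum>i = r..<k. x ^ i) + (\<Sum>i<r. x ^ i)"
  by (simp add: lorenz_poly_def monom_altdef)

text \<open>The two columns solve all but the first two equations of the eigenvector problem
  \<open>M w = x w\<close>, with the entries for the letters \<open>1\<close> and \<open>2\<close> equal to
  \<open>(x ^ k, 0)\<close> and \<open>(0, x ^ k)\<close>.\<close>

definition elim_col :: "nat \<Rightarrow> nat \<Rightarrow> int poly" where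
  "elim_col c l =
    (if l \<le> 2 * r then (if l mod 2 = c then x ^ (k - l div 2) else 0) else x ^ (k + r + c - l))"

text \<open>Completing the two columns by unit vectors gives a lower triangular matrix, and
  multiplying by it on the right clears the lower left block of \<open>N\<close>.\<close>

definition elim_mat :: "int poly mat" where
  "elim_mat = mat k k (\<lambda>(l, c). if c < 2 then elim_col c l else of_bool (l = c))"

abbreviation N :: "int poly mat" where "N \<equiv> char_poly_matrix (subst_matrix k \<zeta>)"

lemma N_carrier: "N \<in> carrier_mat k k"
  by (simp add: subst_matrix_def)

lemma N_index:
  assumes "i < k" "l < k"
  shows "N $$ (i, l) = of_bool (i = l) * x - of_nat (count_list (\<zeta> (l + 1)) (i + 1))"
  using assms by (simp add: char_poly_matrix_def subst_matrix_def of_nat_poly)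

lemma N_mult_index:
  assumes "i < k" "c < k"
  shows "(N * elim_mat) $$ (i, c) =
    (if c < 2 then x * elim_col c i - (\<Sum>l<k. of_nat (count_list (\<zeta> (l + 1)) (i + 1)) * elim_col c l)
     else N $$ (i, c))"
proof -
  have dim: "dim_row N = k" "dim_col N = k" using N_carrier by auto
  have prod: "(N * elim_mat) $$ (i, c) = (\<Sum>l<k. N $$ (i, l) * elim_mat $$ (l, c))"
    using assms dim by (simp add: elim_mat_def scalar_prod_def lessThan_atLeast0)
  show ?thesis
  proof (cases "c < 2")
    case True
    have "(\<Sum>l<k. N $$ (i, l) * elim_mat $$ (l, c)) =
        (\<Sum>l<k. (if i = l then x * elim_col c l else 0)
          - of_nat (count_list (\<zeta> (l + 1)) (i + 1)) * elim_col c l)"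
      using assms True by (intro sum.cong) (auto simp: N_index elim_mat_def left_diff_distrib)
    also have "\<dots> = x * elim_col c i
        - (\<Sum>l<k. of_nat (count_list (\<zeta> (l + 1)) (i + 1)) * elim_col c l)"
      unfolding sum_subtractf using assms by simp
    finally show ?thesis using True prod by simp
  next
    case False
    have "(\<Sum>l<k. N $$ (i, l) * elim_mat $$ (l, c)) = (\<Sum>l<k. if l = c then N $$ (i, l) else 0)"
      using assms False by (intro sum.cong) (auto simp: elim_mat_def)
    then show ?thesis using assms False prod by simp
  qed
qed

lemma N_mult_zero:
  assumes "2 \<le> i" "i < k" "c < 2"
  shows "(N * elim_mat) $$ (i, c) = 0"
proof -
  have "(\<Sum>l<k. of_nat (count_list (\<zeta> (l + 1)) (i + 1)) * elim_col c l) =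
      (\<Sum>l<k. (if l = i - 2 then of_bool (i < 2 * r + 2) * elim_col c l else 0)
        + (if l = i - 1 then of_bool (2 * r < i) * elim_col c l else 0))"
    using assms by (intro sum.cong refl, subst count_zeta) auto
  also have "\<dots> = of_bool (i < 2 * r + 2) * elim_col c (i - 2) + of_bool (2 * r < i) * elim_col c (i - 1)"
  proof -
    have "i - 2 < k" "i - 1 < k" using assms by auto
    then show ?thesis unfolding sum.distrib by simp
  qed
  also have "\<dots> = x * elim_col c i"
  proof -
    consider "i \<le> 2 * r" | "i = 2 * r + 1" | "2 * r + 2 \<le> i" by linarith
    then show ?thesis
    proof cases
      case 1
      obtain j where j: "i = j + 2" using assms(1) by (metis add.commute le_Suc_ex)
      have "k - j div 2 = Suc (k - i div 2)" using 1 j k_gt by simp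
      moreover have "i mod 2 = j mod 2" using j by simp
      ultimately show ?thesis using 1 j by (simp add: elim_col_def)
    next
      \<comment> \<open>The letter \<open>2 * r + 2\<close> is the only one above \<open>2\<close>
        that occurs in two images, of \<open>2 * r\<close> and \<open>2 * r + 1\<close>. By parity
        exactly one of the two entries is nonzero in each column.\<close>
      case 2
      have i: "i - 2 = 2 * r - 1" "i - 1 = 2 * r" using 2 by auto
      have odd: "(2 * r - 1) mod 2 = 1" "(2 * r - 1) div 2 = r - 1" using r_ge by presburger+
      have "c = 0 \<or> c = 1" using assms by auto
      then show ?thesis
      proof
        assume "c = 0"
        moreover have "k - r = Suc (k + r - i)" using 2 k_gt by simp
        ultimately show ?thesis using 2 odd unfolding i by (simp add: elim_col_def)
      next
        assume "c = 1"
        moreover have "k - (r - 1) = Suc (k + r + 1 - i)" using 2 k_gt r_ge by simp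
        ultimately show ?thesis using 2 odd unfolding i by (simp add: elim_col_def)
      qed
    next
      case 3
      then have "k + r + c - (i - 1) = Suc (k + r + c - i)" using assms by simp
      moreover have "\<not> i - 1 \<le> 2 * r" using 3 by simp
      ultimately show ?thesis using 3 by (simp add: elim_col_def)
    qed
  qed
  finally show ?thesis using assms k_gt by (simp add: N_mult_index)
qed

text \<open>Together with \<open>x ^ (r + 1)\<close>, \<open>tail_sum\<close> and
  \<open>head_sum\<close> cut \<open>x\<close> times the sum of \<open>x ^ i\<close> over
  \<open>r \<le> i < k\<close> at the exponent \<open>k - r + 1\<close>. They come from the rows of
  the letters \<open>1\<close> and \<open>2\<close>.\<close>

definition tail_sum :: "int poly" where "tail_sum = (\<Sum>i = r + 2..<k - r + 1. x ^ i)"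

definition head_sum :: "int poly" where "head_sum = (\<Sum>i = k - r + 1..<k + 1. x ^ i)"

lemma sum_elim_col_low: "c < 2 \<Longrightarrow> (\<Sum>l<2 * r. elim_col c l) = head_sum"
proof -
  assume c: "c < 2"
  have "(\<Sum>l<2 * n. if l mod 2 = c then x ^ (k - l div 2) else 0) = (\<Sum>i<n. x ^ (k - i))" for n
    using c by (induction n) (auto simp: less_2_cases_iff)
  moreover have "(\<Sum>l<2 * r. elim_col c l) = (\<Sum>l<2 * r. if l mod 2 = c then x ^ (k - l div 2) else 0)"
    by (intro sum.cong) (auto simp: elim_col_def)
  moreover have "(\<Sum>i<r. x ^ (k - i)) = head_sum"
    unfolding head_sum_def using k_gt
    by (intro sum.reindex_bij_witness[of _ "\<lambda>i. k - i" "\<lambda>i. k - i"]) auto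
  ultimately show ?thesis by simp
qed

lemma sum_elim_col_high:
  "(\<Sum>l = 2 * r..<k. elim_col 0 l) = tail_sum + x ^ (r + 1)"
  "(\<Sum>l = 2 * r..<k. elim_col 1 l) = tail_sum"
proof -
  have "(\<Sum>l = 2 * r..<k. elim_col 0 l) = (\<Sum>l = 2 * r..<k. x ^ (k + r - l))"
    by (intro sum.cong) (auto simp: elim_col_def)
  also have "\<dots> = (\<Sum>i = r + 1..<k - r + 1. x ^ i)"
    using k_gt by (intro sum.reindex_bij_witness[of _ "\<lambda>i. k + r - i" "\<lambda>i. k + r - i"]) auto
  also have "\<dots> = tail_sum + x ^ (r + 1)"
    unfolding tail_sum_def using k_gt by (simp add: sum.atLeast_Suc_lessThan)
  finally show "(\<Sum>l = 2 * r..<k. elim_col 0 l) = tail_sum + x ^ (r + 1)" .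
  have "(\<Sum>l = 2 * r..<k. elim_col 1 l) = elim_col 1 (2 * r) + (\<Sum>l = Suc (2 * r)..<k. elim_col 1 l)"
    using k_gt by (intro sum.atLeast_Suc_lessThan) simp
  also have "elim_col 1 (2 * r) = 0" by (simp add: elim_col_def)
  also have "(\<Sum>l = Suc (2 * r)..<k. elim_col 1 l) = (\<Sum>l = Suc (2 * r)..<k. x ^ (k + r + 1 - l))"
    by (intro sum.cong) (auto simp: elim_col_def)
  also have "\<dots> = tail_sum"
    unfolding tail_sum_def using k_gt
    by (intro sum.reindex_bij_witness[of _ "\<lambda>i. k + r + 1 - i" "\<lambda>i. k + r + 1 - i"]) auto
  finally show "(\<Sum>l = 2 * r..<k. elim_col 1 l) = tail_sum" by simp
qed

lemma N_mult_first_rows: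
  assumes "c < 2"
  shows "(N * elim_mat) $$ (0, c) = x * elim_col c 0 - (\<Sum>l = 2 * r..<k. elim_col c l)"
    "(N * elim_mat) $$ (1, c) = x * elim_col c 1 - head_sum"
proof -
  have "(\<Sum>l<k. of_nat (count_list (\<zeta> (l + 1)) (0 + 1)) * elim_col c l) =
      (\<Sum>l<k. if l \<in> {2 * r..<k} then elim_col c l else 0)"
    using k_gt by (intro sum.cong refl, subst count_zeta) auto
  also have "\<dots> = (\<Sum>l \<in> {..<k} \<inter> {2 * r..<k}. elim_col c l)"
    by (intro sum.inter_restrict[symmetric]) simp
  also have "{..<k} \<inter> {2 * r..<k} = {2 * r..<k}" by auto
  finally show "(N * elim_mat) $$ (0, c) = x * elim_col c 0 - (\<Sum>l = 2 * r..<k. elim_col c l)"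
    using assms k_gt by (simp add: N_mult_index)
  have "(\<Sum>l<k. of_nat (count_list (\<zeta> (l + 1)) (1 + 1)) * elim_col c l) =
      (\<Sum>l<k. if l \<in> {..<2 * r} then elim_col c l else 0)"
    using k_gt by (intro sum.cong refl, subst count_zeta) auto
  also have "\<dots> = (\<Sum>l \<in> {..<k} \<inter> {..<2 * r}. elim_col c l)"
    by (intro sum.inter_restrict[symmetric]) simp
  also have "{..<k} \<inter> {..<2 * r} = {..<2 * r}" using k_gt by auto
  finally show "(N * elim_mat) $$ (1, c) = x * elim_col c 1 - head_sum"
    using assms k_gt by (simp add: N_mult_index sum_elim_col_low)
qed

lemma det_elim_mat: "det elim_mat = x ^ (2 * k)"
proof -
  have "det elim_mat = prod_list (diag_mat elim_mat)"
    by (rule det_lower_triangular[of k])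
      (use r_ge in \<open>auto simp: elim_mat_def elim_col_def\<close>)
  also have "\<dots> = (\<Prod>i = 0..<k. elim_mat $$ (i, i))"
    by (simp add: prod_list_diag_prod elim_mat_def)
  also have "\<dots> = (\<Prod>i = 0..<k. if i < 2 then x ^ k else 1)"
    by (intro prod.cong) (use r_ge in \<open>auto simp: elim_mat_def elim_col_def less_2_cases_iff\<close>)
  also have "\<dots> = (\<Prod>i \<in> {0..<k} \<inter> {..<2}. x ^ k)"
    by (subst prod.inter_restrict) auto
  also have "{0..<k} \<inter> {..<2} = {..<2}" using k_gt by auto
  finally show ?thesis by (simp add: power_mult mult.commute)
qed

lemma det_N_mult:
  "det (N * elim_mat) =
    ((x ^ (k + 1) - tail_sum - x ^ (r + 1)) * (x ^ (k + 1) - head_sum) - tail_sum * head_sum) * x ^ (k - 2)"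
proof -
  define P where "P = N * elim_mat"
  have dim: "dim_row P = k" "dim_col P = k" using N_carrier by (auto simp: P_def elim_mat_def)
  define S where "S = mat 2 2 (\<lambda>(i, j). P $$ (i, j))"
  define B where "B = mat 2 (k - 2) (\<lambda>(i, j). P $$ (i, j + 2))"
  define D where "D = mat (k - 2) (k - 2) (\<lambda>(i, j). N $$ (i + 2, j + 2))"
  have "P = four_block_mat S B (0\<^sub>m (k - 2) 2) D"
  proof (rule eq_matI)
    fix i j
    assume "i < dim_row (four_block_mat S B (0\<^sub>m (k - 2) 2) D)"
      "j < dim_col (four_block_mat S B (0\<^sub>m (k - 2) 2) D)"
    then have ij: "i < k" "j < k" using k_gt by (auto simp: S_def D_def)
    consider "i < 2" "j < 2" | "i < 2" "2 \<le> j" | "2 \<le> i" "j < 2" | "2 \<le> i" "2 \<le> j"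
      by linarith
    then show "P $$ (i, j) = four_block_mat S B (0\<^sub>m (k - 2) 2) D $$ (i, j)"
    proof cases
      case 3
      then show ?thesis using ij k_gt N_mult_zero by (auto simp: P_def S_def D_def)
    next
      case 4
      then have "i - 2 + 2 = i" "j - 2 + 2 = j" by auto
      then show ?thesis using ij 4 k_gt by (auto simp: P_def S_def D_def N_mult_index simp del: index_mult_mat)
    next
      case 2
      then have "j - 2 + 2 = j" by auto
      then show ?thesis using ij 2 k_gt by (simp add: S_def B_def D_def del: add_2_eq_Suc')
    qed (use ij k_gt in \<open>auto simp: S_def D_def\<close>)
  qed (use dim k_gt in \<open>auto simp: S_def D_def\<close>)
  then have "det P = det S * det D"
    by (simp only:) (rule det_four_block_mat_lower_left_zero[of _ 2 _ "k - 2"],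
      auto simp: S_def B_def D_def)
  moreover have "det D = x ^ (k - 2)"
  proof -
    \<comment> \<open>Apart from \<open>1\<close> and \<open>2\<close>, the image of a letter
      contains only larger letters, so \<open>D\<close> is lower triangular.\<close>
    have D: "D $$ (i, j) = of_bool (i = j) * x" if "i \<le> j" "j < k - 2" for i j
      using that N_index[of "i + 2" "j + 2"] count_zeta[of "i + 2" "j + 2"]
      by (simp add: D_def)
    have "det D = prod_list (diag_mat D)"
      by (rule det_lower_triangular[of "k - 2"]) (auto simp: D, auto simp: D_def)
    also have "\<dots> = (\<Prod>i = 0..<k - 2. D $$ (i, i))"
      by (simp add: prod_list_diag_prod D_def)
    also have "\<dots> = (\<Prod>i = 0..<k - 2. x)"
      by (intro prod.cong) (auto simp: D)
    finally show ?thesis by simp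
  qed
  moreover have "det S = (x ^ (k + 1) - tail_sum - x ^ (r + 1)) * (x ^ (k + 1) - head_sum) - tail_sum * head_sum"
  proof -
    have cols: "elim_col 0 0 = x ^ k" "elim_col 1 0 = 0" "elim_col 0 1 = 0" "elim_col 1 1 = x ^ k"
      using r_ge by (auto simp: elim_col_def)
    have "S $$ (0, 0) = x ^ (k + 1) - tail_sum - x ^ (r + 1)"
      using N_mult_first_rows(1)[of 0] unfolding cols sum_elim_col_high
      by (simp add: S_def P_def algebra_simps)
    moreover have "S $$ (0, 1) = - tail_sum"
      using N_mult_first_rows(1)[of 1] unfolding cols sum_elim_col_high
      by (simp add: S_def P_def)
    moreover have "S $$ (1, 0) = - head_sum"
      using N_mult_first_rows(2)[of 0] unfolding cols
      by (simp add: S_def P_def)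
    moreover have "S $$ (1, 1) = x ^ (k + 1) - head_sum"
      using N_mult_first_rows(2)[of 1] unfolding cols
      by (simp add: S_def P_def)
    moreover have "S \<in> carrier_mat 2 2" by (simp add: S_def)
    ultimately show ?thesis by (simp only: det_2_by_2 minus_mult_minus)
  qed
  ultimately show ?thesis by (simp add: P_def)
qed

lemma char_poly_subst_matrix: "char_poly (subst_matrix k \<zeta>) = lorenz_poly k r"
proof -
  have A: "x ^ (r + 1) + tail_sum + head_sum = x * (\<Sum>i = r..<k. x ^ i)"
  proof -
    have "x ^ (r + 1) + tail_sum = (\<Sum>i = r + 1..<k - r + 1. x ^ i)"
      unfolding tail_sum_def using k_gt by (simp add: sum.atLeast_Suc_lessThan)
    also have "\<dots> + head_sum = (\<Sum>i = r + 1..<k + 1. x ^ i)"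
      unfolding head_sum_def using k_gt by (intro sum.atLeastLessThan_concat) auto
    also have "\<dots> = x * (\<Sum>i = r..<k. x ^ i)"
      unfolding sum_power_shift power_one_right ..
    finally show ?thesis .
  qed
  have B: "head_sum = x ^ (k - r + 1) * (\<Sum>i<r. x ^ i)"
    using sum_power_shift[of x 0 "k - r + 1" r] k_gt by (simp only: head_sum_def lessThan_atLeast0) simp
  have "r + 2 \<le> k" using k_gt r_ge by simp
  then obtain d where d: "k = r + 2 + d" by (auto simp: le_iff_add)
  have "det N * x ^ (2 * k) = det (N * elim_mat)"
  proof -
    have "elim_mat \<in> carrier_mat k k" by (simp add: elim_mat_def)
    from det_mult[OF N_carrier this] show ?thesis by (simp only: det_elim_mat)
  qed
  also have "\<dots> = ((x ^ (k + 1) - tail_sum - x ^ (r + 1)) * (x ^ (k + 1) - head_sum)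
      - tail_sum * head_sum) * x ^ (k - 2)"
    by (rule det_N_mult)
  \<comment> \<open>The products \<open>tail_sum * head_sum\<close> cancel, and
    \<open>x ^ (r + 1) * head_sum\<close> is the only product of sums left.\<close>
  also have "\<dots> = (x ^ (k + 1) * x ^ (k + 1) - x ^ (k + 1) * (x ^ (r + 1) + tail_sum + head_sum)
      + x ^ (r + 1) * head_sum) * x ^ (k - 2)"
    by (simp only: algebra_simps)
  also have "\<dots> = lorenz_poly k r * x ^ (2 * k)"
    unfolding A unfolding B lorenz_poly_eq
    by (rule elimination_identity[OF d])
  \<comment> \<open>The nonzero factor \<open>x ^ (2 * k)\<close> cancels in the integral domain of
    integer polynomials.\<close>
  finally show ?thesis by (simp add: char_poly_def)
qed

end

theorem theorem7:
  fixes k r :: nat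
  assumes "k > 2 * r + 1" and "r \<ge> 1"
  shows
    "(fixed_points k (zeta k r) = {} \<and>
      (\<exists>u :: nat \<Rightarrow> nat stream.
         periodic_points k (zeta k r) = u ` {1..r + 1} \<and>
         inj_on u {1..r + 1} \<and>
         (\<forall>j\<in>{1..r + 1}.
            is_word_limit (\<lambda>m. subst_iter (zeta k r) (m * (r + 1)) (2 * j - 1)) (u j)) \<and>
         (\<forall>i\<in>{1..r}. subst_stream (zeta k r) (u i) = u (i + 1)) \<and>
         subst_stream (zeta k r) (u (r + 1)) = u 1)) \<and>
     (\<forall>n\<ge>k.
        subst_iter (zeta k r) n 1 =
          concat (map (\<lambda>i. subst_iter (zeta k r) (n - i) 1) [r + 1..<k - r + 1]) @
          concat (map (\<lambda>i. subst_iter (zeta k r) i 2) [n - r..<n]) \<and>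
        subst_iter (zeta k r) n 2 =
          concat (map (\<lambda>i. subst_iter (zeta k r) (n - i) 1) [r + 1..<k - r]) @
          concat (map (\<lambda>i. subst_iter (zeta k r) i 2) [n - r..<n]) \<and>
        \<not> (\<exists>js. set js \<subseteq> {..<n} \<and>
             subst_iter (zeta k r) n 1 = concat (map (\<lambda>j. subst_iter (zeta k r) j 1) js))) \<and>
     (symbol_return_time (zeta k r) 1 = enat (r + 1) \<and>
      vertex_return_time (subst_graph k (zeta k r)) 1 = enat (r + 1) \<and>
      \<comment> \<open>Rearranging images off the shortest cycle \<open>1, 3, \<dots>, 2r + 1\<close> through \<open>1\<close>, such as
        \<open>2 \<mapsto> 2 4\<close>, leaves the return time unchanged; only substitutions with another
        first letter on that cycle have a larger one.\<close>
      (\<forall>\<eta>. subst_graph k \<eta> = subst_graph k (zeta k r) \<longrightarrow>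
         symbol_return_time \<eta> 1 \<ge> enat (r + 1) \<and>
         (symbol_return_time \<eta> 1 > enat (r + 1) \<longleftrightarrow>
            (\<exists>i\<in>{1..r + 1}. hd (\<eta> (2 * i - 1)) \<noteq> hd (zeta k r (2 * i - 1)))))) \<and>
     char_poly (subst_matrix k (zeta k r)) = lorenz_poly k r \<and>
     (\<forall>n. lorenz_fib k r (n + k) = int (length (subst_iter (zeta k r) n 1)))"
proof -
  interpret lorenz_subst k r by unfold_locales (use assms in auto)
  \<comment> \<open>The point numbered \<open>j\<close> starts with \<open>2 * j - 1\<close>, the
    cycle letter of index \<open>j - 1\<close>; these first letters distinguish the points.\<close>
  define u where "u j = cycle_limit (j - 1)" for j
  have "fixed_points k \<zeta> = {} \<and>
      (\<exists>u. periodic_points k \<zeta> = u ` {1..r + 1} \<and> inj_on u {1..r + 1} \<and>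
         (\<forall>j\<in>{1..r + 1}. is_word_limit (\<lambda>m. Z (m * (r + 1)) (2 * j - 1)) (u j)) \<and>
         (\<forall>i\<in>{1..r}. subst_stream \<zeta> (u i) = u (i + 1)) \<and>
         subst_stream \<zeta> (u (r + 1)) = u 1)"
  proof (intro conjI exI[of _ u] ballI)
    show "fixed_points k \<zeta> = {}" by (rule fixed_points_empty)
    show "periodic_points k \<zeta> = u ` {1..r + 1}"
      unfolding u_def by (rule periodic_points_eq)
    show "inj_on u {1..r + 1}"
    proof (rule inj_onI)
      fix i j assume ij: "i \<in> {1..r + 1}" "j \<in> {1..r + 1}" and "u i = u j"
      then have "cycle_letter (i - 1) = cycle_letter (j - 1)"
        by (metis u_def shd_cycle_limit)
      then have "i - 1 = j - 1" using ij by (subst (asm) cycle_letter_inj) auto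
      then show "i = j" using ij by auto
    qed
    show "is_word_limit (\<lambda>m. Z (m * (r + 1)) (2 * j - 1)) (u j)" if "j \<in> {1..r + 1}" for j
    proof -
      have "cycle_letter (j - 1) = 2 * j - 1" using that by (subst cycle_letter_less) auto
      then show ?thesis using is_word_limit_cycle_limit[of "j - 1"] by (simp only: u_def)
    qed
    show "subst_stream \<zeta> (u i) = u (i + 1)" if "i \<in> {1..r}" for i
      using that by (simp add: u_def subst_stream_cycle_limit)
    show "subst_stream \<zeta> (u (r + 1)) = u 1"
      unfolding u_def subst_stream_cycle_limit
      by (rule cycle_limit_cong) (simp add: cycle_letter_def)
  qed
  moreover have "\<forall>n\<ge>k.
      Z n 1 = concat (map (\<lambda>i. Z (n - i) 1) [r + 1..<k - r + 1]) @
          concat (map (\<lambda>i. Z i 2) [n - r..<n]) \<and>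
      Z n 2 = concat (map (\<lambda>i. Z (n - i) 1) [r + 1..<k - r]) @
          concat (map (\<lambda>i. Z i 2) [n - r..<n]) \<and>
      \<not> (\<exists>js. set js \<subseteq> {..<n} \<and> Z n 1 = concat (map (\<lambda>j. Z j 1) js))"
    using Z_one_decomp Z_two_decomp Z_one_indecomposable by blast
  moreover have "\<forall>\<eta>. subst_graph k \<eta> = graph \<longrightarrow>
      symbol_return_time \<eta> 1 \<ge> enat (r + 1) \<and>
      (symbol_return_time \<eta> 1 > enat (r + 1) \<longleftrightarrow>
        (\<exists>i\<in>{1..r + 1}. hd (\<eta> (2 * i - 1)) \<noteq> hd (\<zeta> (2 * i - 1))))"
    using other_symbol_return_time_ge other_symbol_return_time_gt_iff by blast
  ultimately show ?thesis
    using symbol_return_time_one vertex_return_time_one char_poly_subst_matrix lorenz_fib_eq_length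
    by blast
qed

end
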